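(* The representations $V_{\lambda^{(m)}}$ of the algebra $H(m,1,n)$, where $\lambda^{(m)}$ runs over the $m$-partitions of $n$, are irreducible and pairwise non-isomorphic.
   Context: Parameters. Let $m,n\ge 1$. Either $K=\mathbb{C}(q,v_1,\dots,v_m)$ with $q,v_1,\dots,v_m$ indeterminates, or $K=\mathbb{C}$ and $q,v_1,\dots,v_m\in\mathbb{C}$, $q\neq0$, satisfy: $1+q^2+\dots+q^{2N}\neq0$ for all non-negative integers $N<n$; $q^{2i}v_j-v_k\neq0$ for all $i,j,k$ with $j\neq k$ and $-n<i<n$; $v_j\neq0$ for all $j=1,\dots,m$. Cyclotomic Hecke algebra. $H(m,1,n)$ is the associative unital $K$-algebra generated by $\tau,\sigma_1,\dots,\sigma_{n-1}$ with defining relations $\sigma_i\sigma_{i+1}\sigma_i=\sigma_{i+1}\sigma_i\sigma_{i+1}$; $\sigma_i\sigma_j=\sigma_j\sigma_i$ if $|i-j|>1$; $\tau\sigma_1\tau\sigma_1=\sigma_1\tau\sigma_1\tau$; $\tau\sigma_i=\sigma_i\tau$ for $i>1$; $\sigma_i^2=(q-q^{-1})\sigma_i+1$; $(\tau-v_1)\cdots(\tau-v_m)=0$. Tableaux. An $m$-partition of $n$ is an $m$-tuple $\lambda^{(m)}=(\lambda_1,\dots,\lambda_m)$ of partitions (Young diagrams) with $|\lambda_1|+\dots+|\lambda_m|=n$. Its $m$-nodes are the nodes of the diagrams together with the index $k$ of the diagram. The content of the $m$-node in row $r$ and column $s$ of the $k$-th diagram is $v_kq^{2(s-r)}$. A standard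 $m$-tableau of shape $\lambda^{(m)}$ is a bijective filling of the $m$-nodes with $1,\dots,n$ such that in every diagram the numbers increase along rows (to the right) and columns (downwards). $c(X_{\lambda^{(m)}}|i)$ is the content of the $m$-node carrying $i$ in $X_{\lambda^{(m)}}$. $X_{\lambda^{(m)}}^{s_i}$ is obtained by exchanging $i$ and $i+1$. Representations $V_{\lambda^{(m)}}$. $V_{\lambda^{(m)}}$ is the $H(m,1,n)$-module with $K$-basis $\{\mathcal{X}_{\lambda^{(m)}}\}$ indexed by the standard $m$-tableaux $X_{\lambda^{(m)}}$ of shape $\lambda^{(m)}$, and action (with $c^{(i)}:=c(X_{\lambda^{(m)}}|i)$) $$\tau(\mathcal{X}_{\lambda^{(m)}})=c^{(1)}\mathcal{X}_{\lambda^{(m)}},\qquad \sigma_i(\mathcal{X}_{\lambda^{(m)}})=\frac{(q-q^{-1})c^{(i+1)}}{c^{(i+1)}-c^{(i)}}\mathcal{X}_{\lambda^{(m)}}+\frac{qc^{(i+1)}-q^{-1}c^{(i)}}{c^{(i+1)}-c^{(i)}}\mathcal{X}_{\lambda^{(m)}}^{s_i},$$ where $\mathcal{X}_{\lambda^{(m)}}^{s_i}$ is the basis vector of $X_{\lambda^{(m)}}^{s_i}$ if this $m$-tableau is standard and $0$ otherwise.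
   Formalization: The parameter restrictions allow q^2=1, where the formula for σ_i reads 0/0 when i and i+1 lie in the same diagram; there the coefficients are taken to be their limits q/d and q(d+1)/d, with d the difference of the diagonals s-r of the nodes of i+1 and i. Elsewhere the formula is unchanged. *)

theory Defs
  imports
    Complex_Main
    "HOL-Library.Poly_Mapping"
    "HOL-Library.Option_ord"
    "HOL-Library.FuncSet"
    "HOL-Combinatorics.Transposition"
    "HOL-Computational_Algebra.Fraction_Field"
    "HOL-Algebra.QuotRing"
    "HOL-Algebra.Module"
begin

text \<open>The locale \<open>module\<close> of HOL-Algebra requires a commutative ring of scalars; the following
  is the same list of axioms over an arbitrary ring.\<close>

locale left_module = R?: ring R + M?: abelian_group M for R (structure) and M (structure) +
  assumes lsmult_closed:
      "\<lbrakk>a \<in> carrier R; x \<in> carrier M\<rbrakk> \<Longrightarrow> a \<odot>\<^bsub>M\<^esub> x \<in> carrier M"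
    and lsmult_l_distr:
      "\<lbrakk>a \<in> carrier R; b \<in> carrier R; x \<in> carrier M\<rbrakk> \<Longrightarrow>
        (a \<oplus> b) \<odot>\<^bsub>M\<^esub> x = a \<odot>\<^bsub>M\<^esub> x \<oplus>\<^bsub>M\<^esub> b \<odot>\<^bsub>M\<^esub> x"
    and lsmult_r_distr:
      "\<lbrakk>a \<in> carrier R; x \<in> carrier M; y \<in> carrier M\<rbrakk> \<Longrightarrow>
        a \<odot>\<^bsub>M\<^esub> (x \<oplus>\<^bsub>M\<^esub> y) = a \<odot>\<^bsub>M\<^esub> x \<oplus>\<^bsub>M\<^esub> a \<odot>\<^bsub>M\<^esub> y"
    and lsmult_assoc:
      "\<lbrakk>a \<in> carrier R; b \<in> carrier R; x \<in> carrier M\<rbrakk> \<Longrightarrow>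
        (a \<otimes> b) \<odot>\<^bsub>M\<^esub> x = a \<odot>\<^bsub>M\<^esub> (b \<odot>\<^bsub>M\<^esub> x)"
    and lsmult_one:
      "x \<in> carrier M \<Longrightarrow> \<one> \<odot>\<^bsub>M\<^esub> x = x"

definition irreducible_left_module ::
    "('a, 'r) ring_scheme \<Rightarrow> ('a, 'b) module \<Rightarrow> bool" where
  "irreducible_left_module R M \<longleftrightarrow>
     left_module R M \<and> carrier M \<noteq> {\<zero>\<^bsub>M\<^esub>} \<and>
     (\<forall>N. submodule N R M \<longrightarrow> N = {\<zero>\<^bsub>M\<^esub>} \<or> N = carrier M)"

definition left_module_iso ::
    "('a, 'r) ring_scheme \<Rightarrow> ('a, 'b) module \<Rightarrow> ('a, 'c) module \<Rightarrow> ('b \<Rightarrow> 'c) set" where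
  "left_module_iso R M N =
     {f. bij_betw f (carrier M) (carrier N) \<and>
         (\<forall>x\<in>carrier M. \<forall>y\<in>carrier M. f (x \<oplus>\<^bsub>M\<^esub> y) = f x \<oplus>\<^bsub>N\<^esub> f y) \<and>
         (\<forall>a\<in>carrier R. \<forall>x\<in>carrier M. f (a \<odot>\<^bsub>M\<^esub> x) = a \<odot>\<^bsub>N\<^esub> f x)}"

definition isomorphic_left_modules ::
    "('a, 'r) ring_scheme \<Rightarrow> ('a, 'b) module \<Rightarrow> ('a, 'c) module \<Rightarrow> bool" where
  "isomorphic_left_modules R M N \<longleftrightarrow> left_module_iso R M N \<noteq> {}"

text \<open>Words under concatenation. Written additively, because \<open>Poly_Mapping\<close> turns
  finitely supported functions on an additive monoid into its monoid algebra.\<close>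

datatype 'g word = Word (letters: "'g list")

instantiation word :: (type) monoid_add
begin

definition zero_word :: "'a word" where
  "0 = Word []"

definition plus_word :: "'a word \<Rightarrow> 'a word \<Rightarrow> 'a word" where
  "u + w = Word (letters u @ letters w)"

instance
  by standard (simp_all add: zero_word_def plus_word_def)

end

type_synonym ('g, 'k) free_alg = "'g word \<Rightarrow>\<^sub>0 'k"

definition fa_gen :: "'g \<Rightarrow> ('g, 'k::field) free_alg" where
  "fa_gen g = Poly_Mapping.single (Word [g]) 1"

definition fa_const :: "'k \<Rightarrow> ('g, 'k::field) free_alg" where
  "fa_const c = Poly_Mapping.single 0 c"

definition free_algebra :: "'g set \<Rightarrow> ('g, 'k::field) free_alg ring" where
  "free_algebra S =
     \<lparr>carrier = {f. \<forall>w\<in>Poly_Mapping.keys f. set (letters w) \<subseteq> S},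
      mult = (*), one = 1, zero = 0, add = (+)\<rparr>"

text \<open>The index set \<open>{1, \<dots>, m}\<close> is rendered by a finite, linearly ordered type \<open>'m\<close>,
  so that \<open>m = CARD('m)\<close>.\<close>

datatype hecke_gen = Tau | Sigma nat

definition hecke_gens :: "nat \<Rightarrow> hecke_gen set" where
  "hecke_gens n = insert Tau (Sigma ` {1..<n})"

abbreviation fa_tau :: "(hecke_gen, 'k::field) free_alg" where
  "fa_tau \<equiv> fa_gen Tau"

abbreviation fa_sigma :: "nat \<Rightarrow> (hecke_gen, 'k::field) free_alg" where
  "fa_sigma i \<equiv> fa_gen (Sigma i)"

definition hecke_relators ::
    "'k::field \<Rightarrow> ('m::{finite,linorder} \<Rightarrow> 'k) \<Rightarrow> nat \<Rightarrow> (hecke_gen, 'k) free_alg set" where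
  "hecke_relators q v n =
     {fa_sigma i * fa_sigma (i + 1) * fa_sigma i - fa_sigma (i + 1) * fa_sigma i * fa_sigma (i + 1)
        | i. 1 \<le> i \<and> i + 1 < n} \<union>
     {fa_sigma i * fa_sigma j - fa_sigma j * fa_sigma i
        | i j. i \<in> {1..<n} \<and> j \<in> {1..<n} \<and> \<bar>int i - int j\<bar> > 1} \<union>
     (if 1 < n
      then {fa_tau * fa_sigma 1 * fa_tau * fa_sigma 1 - fa_sigma 1 * fa_tau * fa_sigma 1 * fa_tau}
      else {}) \<union>
     {fa_tau * fa_sigma i - fa_sigma i * fa_tau | i. 1 < i \<and> i < n} \<union>
     {fa_sigma i ^ 2 - (fa_const (q - inverse q) * fa_sigma i + 1) | i. 1 \<le> i \<and> i < n} \<union>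
     {prod_list (map (\<lambda>j. fa_tau - fa_const (v j)) (sorted_list_of_set UNIV))}"

definition hecke_algebra ::
    "'k::field \<Rightarrow> ('m::{finite,linorder} \<Rightarrow> 'k) \<Rightarrow> nat \<Rightarrow> (hecke_gen, 'k) free_alg set ring" where
  "hecke_algebra q v n =
     free_algebra (hecke_gens n)
       Quot (Idl\<^bsub>free_algebra (hecke_gens n)\<^esub> (hecke_relators q v n))"

text \<open>A partition is the weakly decreasing list of its nonzero parts. A node is a triple
  (component, row, column), rows and columns being numbered from 1.\<close>

type_synonym 'm mnode = "'m \<times> nat \<times> nat"
type_synonym 'm mtableau = "'m mnode \<Rightarrow> nat"

definition is_partition :: "nat list \<Rightarrow> bool" where
  "is_partition p \<longleftrightarrow> sorted_wrt (\<ge>) p \<and> 0 \<notin> set p"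

definition multipartitions :: "nat \<Rightarrow> ('m::finite \<Rightarrow> nat list) set" where
  "multipartitions n = {\<nu>. (\<forall>k. is_partition (\<nu> k)) \<and> (\<Sum>k\<in>UNIV. sum_list (\<nu> k)) = n}"

definition mnodes :: "('m \<Rightarrow> nat list) \<Rightarrow> 'm mnode set" where
  "mnodes \<nu> = {(k, r, s). 1 \<le> r \<and> r \<le> length (\<nu> k) \<and> 1 \<le> s \<and> s \<le> \<nu> k ! (r - 1)}"

text \<open>A tableau maps nodes to entries, extensionally (\<open>undefined\<close> off the diagram), so that
  distinct functions are distinct tableaux.\<close>

definition standard_mtableaux :: "nat \<Rightarrow> ('m \<Rightarrow> nat list) \<Rightarrow> 'm mtableau set" where
  "standard_mtableaux n \<nu> =
     {X \<in> mnodes \<nu> \<rightarrow>\<^sub>E {1..n}.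
        bij_betw X (mnodes \<nu>) {1..n} \<and>
        (\<forall>k r s s'. (k, r, s) \<in> mnodes \<nu> \<and> (k, r, s') \<in> mnodes \<nu> \<and> s < s'
            \<longrightarrow> X (k, r, s) < X (k, r, s')) \<and>
        (\<forall>k r r' s. (k, r, s) \<in> mnodes \<nu> \<and> (k, r', s) \<in> mnodes \<nu> \<and> r < r'
            \<longrightarrow> X (k, r, s) < X (k, r', s))}"

definition node_of :: "('m \<Rightarrow> nat list) \<Rightarrow> 'm mtableau \<Rightarrow> nat \<Rightarrow> 'm mnode" where
  "node_of \<nu> X i = inv_into (mnodes \<nu>) X i"

definition node_diag :: "'m mnode \<Rightarrow> int" where
  "node_diag = (\<lambda>(k, r, s). int s - int r)"

definition node_content :: "'k::field \<Rightarrow> ('m \<Rightarrow> 'k) \<Rightarrow> 'm mnode \<Rightarrow> 'k" where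
  "node_content q v b = v (fst b) * q powi (2 * node_diag b)"

definition swap_entries :: "('m \<Rightarrow> nat list) \<Rightarrow> nat \<Rightarrow> 'm mtableau \<Rightarrow> 'm mtableau" where
  "swap_entries \<nu> i X = (\<lambda>b\<in>mnodes \<nu>. transpose i (i + 1) (X b))"

text \<open>Here \<open>b\<close> and \<open>b'\<close> are the nodes carrying \<open>i\<close> and \<open>i + 1\<close>, with contents \<open>c\<close> and \<open>c'\<close>.
  The \<open>else\<close> branches are the usual formulas. For admissible parameters their denominator
  \<open>c' - c\<close> vanishes on a standard tableau only if \<open>q\<^sup>2 = 1\<close> and the two nodes lie in the same
  diagram (then necessarily on distinct diagonals). There the formulas read 0/0, and the
  coefficient is by definition their limit as the first parameter tends to \<open>q\<close>; the two lemmas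
  below compute these limits, with \<open>d\<close> the difference of the diagonals.\<close>

definition sigma_diag_coeff :: "'k::field \<Rightarrow> ('m \<Rightarrow> 'k) \<Rightarrow> 'm mnode \<Rightarrow> 'm mnode \<Rightarrow> 'k" where
  "sigma_diag_coeff q v b b' =
     (let c = node_content q v b; c' = node_content q v b'; d = node_diag b' - node_diag b
      in if c' = c then q / of_int d
         else ((q - inverse q) * c') / (c' - c))"

definition sigma_swap_coeff :: "'k::field \<Rightarrow> ('m \<Rightarrow> 'k) \<Rightarrow> 'm mnode \<Rightarrow> 'm mnode \<Rightarrow> 'k" where
  "sigma_swap_coeff q v b b' =
     (let c = node_content q v b; c' = node_content q v b'; d = node_diag b' - node_diag b
      in if c' = c then q * of_int (d + 1) / of_int d
         else (q * c' - inverse q * c) / (c' - c))"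

lemma tendsto_quotient_of_derivs:
  fixes f g :: "complex \<Rightarrow> complex"
  assumes "(f has_field_derivative f') (at a)" "(g has_field_derivative g') (at a)"
    and "f a = 0" "g a = 0" "g' \<noteq> 0"
  shows "((\<lambda>x. f x / g x) \<longlongrightarrow> f' / g') (at a)"
proof -
  have "((\<lambda>x. ((f x - f a) / (x - a)) / ((g x - g a) / (x - a))) \<longlongrightarrow> f' / g') (at a)"
    using assms(1,2,5) by (intro tendsto_divide) (simp_all add: has_field_derivative_iff)
  moreover have "eventually (\<lambda>x. ((f x - f a) / (x - a)) / ((g x - g a) / (x - a)) = f x / g x) (at a)"
    using assms(3,4) by (auto simp: eventually_at intro!: exI[of _ 1])
  ultimately show ?thesis
    by (rule Lim_transform_eventually)
qed

lemma content_diff_deriv: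
  fixes q w :: complex and a b :: int
  assumes "q^2 = 1"
  shows "((\<lambda>x. w * x powi (2 * b) - w * x powi (2 * a)) has_field_derivative
           2 * w * of_int (b - a) / q) (at q)"
    and "w * q powi (2 * b) - w * q powi (2 * a) = 0"
    and "q powi (2 * a) = 1"
proof -
  from assms have q: "q \<noteq> 0" by auto
  have p: "q powi (2 * c) = 1" for c
    using assms by (metis power_int_mult power_int_numeral power_int_1_left)
  have p': "q powi (2 * c - 1) = 1 / q" for c
    using q p[of c] by (simp add: power_int_diff)
  show "((\<lambda>x. w * x powi (2 * b) - w * x powi (2 * a)) has_field_derivative
           2 * w * of_int (b - a) / q) (at q)"
    using q by (auto intro!: derivative_eq_intros simp: p' p'[unfolded mult.commute[of 2]] field_simps)
  show "w * q powi (2 * b) - w * q powi (2 * a) = 0" "q powi (2 * a) = 1"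
    by (simp_all add: p)
qed

lemma sigma_diag_coeff_limit:
  fixes q :: complex and v :: "'m \<Rightarrow> complex"
  assumes "q^2 = 1" "v (fst b) \<noteq> 0" "fst b' = fst b" "node_diag b \<noteq> node_diag b'"
  shows "((\<lambda>x. ((x - inverse x) * node_content x v b') / (node_content x v b' - node_content x v b))
           \<longlongrightarrow> sigma_diag_coeff q v b b') (at q)"
proof -
  let ?w = "v (fst b)" and ?a = "node_diag b" and ?b = "node_diag b'"
  from assms(1) have q: "q \<noteq> 0" by auto
  have inv: "inverse q = q" using assms(1) q by (simp add: power2_eq_square field_simps)
  have p: "q powi (2 * c) = 1" for c
    using content_diff_deriv(3)[OF assms(1)] .
  have "((\<lambda>x. (x - inverse x) * (?w * x powi (2 * ?b))) has_field_derivative 2 * ?w) (at q)"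
    using q assms(1) by (auto intro!: derivative_eq_intros simp: p inv power2_eq_square)
  from tendsto_quotient_of_derivs[OF this content_diff_deriv(1)[OF assms(1), of ?w ?b ?a]]
  have "((\<lambda>x. ((x - inverse x) * (?w * x powi (2 * ?b))) /
              (?w * x powi (2 * ?b) - ?w * x powi (2 * ?a)))
          \<longlongrightarrow> 2 * ?w / (2 * ?w * of_int (?b - ?a) / q)) (at q)"
    using assms(2,4) q by (simp add: p inv)
  moreover have "2 * ?w / (2 * ?w * of_int (?b - ?a) / q) = sigma_diag_coeff q v b b'"
    using assms(2,3) by (simp add: sigma_diag_coeff_def node_content_def p)
  ultimately show ?thesis
    using assms(3) by (simp add: node_content_def)
qed

lemma sigma_swap_coeff_limit:
  fixes q :: complex and v :: "'m \<Rightarrow> complex"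
  assumes "q^2 = 1" "v (fst b) \<noteq> 0" "fst b' = fst b" "node_diag b \<noteq> node_diag b'"
  shows "((\<lambda>x. (x * node_content x v b' - inverse x * node_content x v b) /
                 (node_content x v b' - node_content x v b))
           \<longlongrightarrow> sigma_swap_coeff q v b b') (at q)"
proof -
  let ?w = "v (fst b)" and ?a = "node_diag b" and ?b = "node_diag b'"
  from assms(1) have q: "q \<noteq> 0" by auto
  have inv: "inverse q = q" using assms(1) q by (simp add: power2_eq_square field_simps)
  have p: "q powi (2 * c) = 1" for c
    using content_diff_deriv(3)[OF assms(1)] .
  have p': "q powi (2 * c - 1) = q" for c
    using q p[of c] inv by (simp add: power_int_diff field_simps)
  have qq: "q * q = 1" "q * (q * z) = z" for z
    using assms(1) by (simp_all add: power2_eq_square flip: mult.assoc)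
  have "((\<lambda>x. x * (?w * x powi (2 * ?b)) - inverse x * (?w * x powi (2 * ?a)))
          has_field_derivative 2 * ?w * of_int (?b - ?a + 1)) (at q)"
    using q by (auto intro!: derivative_eq_intros simp: p p' p[unfolded mult.commute[of 2]] p'[unfolded mult.commute[of 2]] inv qq algebra_simps)
  from tendsto_quotient_of_derivs[OF this content_diff_deriv(1)[OF assms(1), of ?w ?b ?a]]
  have "((\<lambda>x. (x * (?w * x powi (2 * ?b)) - inverse x * (?w * x powi (2 * ?a))) /
              (?w * x powi (2 * ?b) - ?w * x powi (2 * ?a)))
          \<longlongrightarrow> 2 * ?w * of_int (?b - ?a + 1) / (2 * ?w * of_int (?b - ?a) / q)) (at q)"
    using assms(2,4) q by (simp add: p inv)
  moreover have "2 * ?w * of_int (?b - ?a + 1) / (2 * ?w * of_int (?b - ?a) / q)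
      = sigma_swap_coeff q v b b'"
    using assms(2,3) by (simp add: sigma_swap_coeff_def node_content_def p)
  ultimately show ?thesis
    using assms(3) by (simp add: node_content_def)
qed

text \<open>A vector is the family of its coordinates with respect to the basis of standard tableaux
  and vanishes at every other tableau.\<close>

type_synonym ('m, 'k) tvec = "'m mtableau \<Rightarrow> 'k"

definition basis_vec :: "'m mtableau \<Rightarrow> ('m, 'k::field) tvec" where
  "basis_vec X = (\<lambda>Y. if Y = X then 1 else 0)"

fun gen_on_basis ::
    "'k::field \<Rightarrow> ('m \<Rightarrow> 'k) \<Rightarrow> nat \<Rightarrow> ('m \<Rightarrow> nat list) \<Rightarrow>
     hecke_gen \<Rightarrow> 'm mtableau \<Rightarrow> ('m, 'k) tvec" where
  "gen_on_basis q v n \<nu> Tau X =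
     (\<lambda>Y. node_content q v (node_of \<nu> X 1) * basis_vec X Y)"
| "gen_on_basis q v n \<nu> (Sigma i) X =
     (\<lambda>Y. sigma_diag_coeff q v (node_of \<nu> X i) (node_of \<nu> X (i + 1)) * basis_vec X Y +
          sigma_swap_coeff q v (node_of \<nu> X i) (node_of \<nu> X (i + 1)) *
            (if swap_entries \<nu> i X \<in> standard_mtableaux n \<nu>
             then basis_vec (swap_entries \<nu> i X) Y else 0))"

definition gen_action ::
    "'k::field \<Rightarrow> ('m \<Rightarrow> 'k) \<Rightarrow> nat \<Rightarrow> ('m \<Rightarrow> nat list) \<Rightarrow>
     hecke_gen \<Rightarrow> ('m, 'k) tvec \<Rightarrow> ('m, 'k) tvec" where
  "gen_action q v n \<nu> g x =
     (\<lambda>Y. \<Sum>X\<in>standard_mtableaux n \<nu>. x X * gen_on_basis q v n \<nu> g X Y)"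

definition free_action ::
    "'k::field \<Rightarrow> ('m \<Rightarrow> 'k) \<Rightarrow> nat \<Rightarrow> ('m \<Rightarrow> nat list) \<Rightarrow>
     (hecke_gen, 'k) free_alg \<Rightarrow> ('m, 'k) tvec \<Rightarrow> ('m, 'k) tvec" where
  "free_action q v n \<nu> f x =
     (\<lambda>Y. \<Sum>w\<in>Poly_Mapping.keys f.
        Poly_Mapping.lookup f w * foldr (gen_action q v n \<nu>) (letters w) x Y)"

text \<open>An element \<open>h\<close> of the Hecke algebra is a coset in the free algebra; it acts by the common
  value of the actions of all its representatives.\<close>

definition V_module ::
    "'k::field \<Rightarrow> ('m::finite \<Rightarrow> 'k) \<Rightarrow> nat \<Rightarrow> ('m \<Rightarrow> nat list) \<Rightarrow>
     ((hecke_gen, 'k) free_alg set, ('m, 'k) tvec) module" where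
  "V_module q v n \<nu> =
     \<lparr>carrier = {x. \<forall>X. X \<notin> standard_mtableaux n \<nu> \<longrightarrow> x X = 0},
      mult = undefined, one = undefined,
      zero = (\<lambda>X. 0), add = (\<lambda>x y X. x X + y X),
      smult = (\<lambda>h x. the_elem ((\<lambda>f. free_action q v n \<nu> f x) ` h))\<rparr>"

text \<open>\<open>'m option \<Rightarrow>\<^sub>0 nat\<close> is the type of monomials in \<open>m + 1\<close> indeterminates, so the fraction field
  below is \<open>\<complex>(q, v\<^sub>1, \<dots>, v\<^sub>m)\<close>; \<open>None\<close> indexes \<open>q\<close> and \<open>Some j\<close> indexes \<open>v\<^sub>j\<close>.\<close>

type_synonym 'm generic_field = "(('m option \<Rightarrow>\<^sub>0 nat) \<Rightarrow>\<^sub>0 complex) fract"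

definition indet :: "'m::{finite,linorder} option \<Rightarrow> 'm generic_field" where
  "indet p = Fract (Poly_Mapping.single (Poly_Mapping.single p 1) 1) 1"

definition generic_q :: "'m::{finite,linorder} generic_field" where
  "generic_q = indet None"

definition generic_v :: "'m::{finite,linorder} \<Rightarrow> 'm generic_field" where
  "generic_v j = indet (Some j)"

definition admissible_parameters :: "complex \<Rightarrow> ('m \<Rightarrow> complex) \<Rightarrow> nat \<Rightarrow> bool" where
  "admissible_parameters q v n \<longleftrightarrow>
     q \<noteq> 0 \<and>
     (\<forall>N<n. (\<Sum>i\<le>N. q ^ (2 * i)) \<noteq> 0) \<and>
     (\<forall>i::int. \<forall>j k. j \<noteq> k \<and> - int n < i \<and> i < int n \<longrightarrow> q powi (2 * i) * v j - v k \<noteq> 0) \<and>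
     (\<forall>j. v j \<noteq> 0)"

end

theory Submission
  imports Defs "HOL-Library.Product_Lexorder"
begin

text \<open>The Jucys-Murphy elements \<open>J\<^sub>1 = \<tau>\<close>, \<open>J\<^sub>i\<^sub>+\<^sub>1 = \<sigma>\<^sub>i J\<^sub>i \<sigma>\<^sub>i\<close> act diagonally, with the contents as
  eigenvalues. For \<open>q\<^sup>2 = 1\<close>, where the contents only depend on the component, one adds the elements
  \<open>B\<^sub>1 = 0\<close>, \<open>B\<^sub>i\<^sub>+\<^sub>1 = \<sigma>\<^sub>i B\<^sub>i \<sigma>\<^sub>i + q \<sigma>\<^sub>i P\<close>, where \<open>P\<close> is a polynomial in \<open>J\<^sub>i\<close>, \<open>J\<^sub>i\<^sub>+\<^sub>1\<close> that projects to the
  tableaux with \<open>i\<close> and \<open>i + 1\<close> in the same component; their eigenvalues are the diagonals. These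
  eigenvalues separate any two standard tableaux, of the same or of different shapes, so that the
  algebra contains the projections to the basis vectors. This gives the inequivalence, and the
  irreducibility because admissible swaps connect all standard tableaux of a shape and the
  corresponding coefficients of \<open>\<sigma>\<^sub>i\<close> do not vanish. The relations themselves only use the identities
  \<open>a(x,y) + a(y,x) = q - q\<^sup>-\<^sup>1\<close>, \<open>a(x,y) (c(y) - c(x)) = (q - q\<^sup>-\<^sup>1) c(y)\<close> and
  \<open>a(x,y) a(y,z) = a(x,z) (a(x,y) + a(y,z) - q + q\<^sup>-\<^sup>1)\<close> of the diagonal coefficients \<open>a\<close>, which hold
  for all admissible parameters, including the limiting ones.\<close>

section \<open>The action of the free algebra\<close>

text \<open>The obstacle is that the parameter conditions stop at \<open>n\<close>, so diagonals of
  nodes from possibly different shapes must be bounded sharply. The bounds come from counting the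
  nodes of the first row and first column that must carry smaller entries (\<open>hook\<close>). In
  one component the relevant diagonals differ by at most \<open>n\<close>, the range of the sums 1 +
  q^2 + ... + q^(2N) with N < n; in different components the hooks are disjoint and the difference
  stays below \<open>n\<close>, the range of the condition on q^(2i) v_j - v_k. Equal contents then
  force q^2 = 1 and a common component. There the sums say that 1, ..., n are nonzero in the field,
  so the diagonals still differ in it; a diagonal d is, up to a factor, the first-order term of the
  content v q^(2d), which the Jucys-Murphy elements lose at q^2 = 1. The relations are checked on
  coordinates rather than on basis vectors: each \<sigma> becomes a formula with two terms, at a
  filling and at its swap, and a relation becomes a polynomial identity in the coefficients.\<close>

lemma poly_mapping_add_induct [case_names zero single add]:
  assumes "P 0" "\<And>w c. P (Poly_Mapping.single w c)"
    "\<And>f g. P f \<Longrightarrow> P g \<Longrightarrow> P (f + g)"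
  shows "P (f :: 'a \<Rightarrow>\<^sub>0 'b::comm_monoid_add)"
proof (induction f rule: update_induct)
  case const
  then show ?case by (rule assms)
next
  case (update f a b)
  have "Poly_Mapping.update a b f = f + Poly_Mapping.single a b"
    using update(1)
    by (intro poly_mapping_eqI) (auto simp: lookup_update lookup_add lookup_single in_keys_iff when_def)
  with update assms show ?case by metis
qed

lemma keys_uminus: "Poly_Mapping.keys (- f) = Poly_Mapping.keys (f :: 'a \<Rightarrow>\<^sub>0 'b::ab_group_add)"
  by (auto simp: in_keys_iff)

lemma ring_free_algebra: "ring (free_algebra S :: (_, 'k::field) free_alg ring)"
proof -
  have mult: "x * y \<in> carrier (free_algebra S)"
    if "x \<in> carrier (free_algebra S)" "y \<in> carrier (free_algebra S)"
    for x y :: "(_, 'k) free_alg"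
  proof -
    have "set (letters w) \<subseteq> S" if "w \<in> Poly_Mapping.keys (x * y)" for w
      using keys_mult[of x y] that \<open>x \<in> _\<close> \<open>y \<in> _\<close>
      by (fastforce simp: free_algebra_def plus_word_def)
    then show ?thesis by (simp add: free_algebra_def)
  qed
  have add: "x + y \<in> carrier (free_algebra S)"
    if "x \<in> carrier (free_algebra S)" "y \<in> carrier (free_algebra S)"
    for x y :: "(_, 'k) free_alg"
    using keys_add[of x y] that by (fastforce simp: free_algebra_def)
  have one: "1 \<in> carrier (free_algebra S :: (_, 'k) free_alg ring)"
    by (simp add: free_algebra_def zero_word_def)
  have zero: "0 \<in> carrier (free_algebra S :: (_, 'k) free_alg ring)"
    by (simp add: free_algebra_def)
  have uminus: "- x \<in> carrier (free_algebra S)"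
    if "x \<in> carrier (free_algebra S)" for x :: "(_, 'k) free_alg"
    using that by (simp add: free_algebra_def keys_uminus)
  have ops: "x \<otimes>\<^bsub>free_algebra S\<^esub> y = x * y" "x \<oplus>\<^bsub>free_algebra S\<^esub> y = x + y"
    "\<one>\<^bsub>free_algebra S\<^esub> = (1 :: (_, 'k) free_alg)" "\<zero>\<^bsub>free_algebra S\<^esub> = (0 :: (_, 'k) free_alg)"
    for x y :: "(_, 'k) free_alg"
    by (simp_all add: free_algebra_def)
  show ?thesis
  proof (intro ringI abelian_groupI monoidI)
    fix x :: "(_, 'k) free_alg" assume "x \<in> carrier (free_algebra S)"
    then show "\<exists>y\<in>carrier (free_algebra S). y \<oplus>\<^bsub>free_algebra S\<^esub> x = \<zero>\<^bsub>free_algebra S\<^esub>"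
      using uminus by (intro bexI[of _ "- x"]) (auto simp: ops)
  qed (auto simp: ops mult add one zero algebra_simps)
qed

lemma free_algebra_simps [simp]:
  "x \<otimes>\<^bsub>free_algebra S\<^esub> y = x * y" "x \<oplus>\<^bsub>free_algebra S\<^esub> y = x + y"
  "\<one>\<^bsub>free_algebra S\<^esub> = 1" "\<zero>\<^bsub>free_algebra S\<^esub> = 0"
  by (simp_all add: free_algebra_def)

lemma free_algebra_a_inv:
  assumes "f \<in> carrier (free_algebra S :: (_, 'k::field) free_alg ring)"
  shows "\<ominus>\<^bsub>free_algebra S\<^esub> f = - f"
proof -
  interpret ring "free_algebra S :: (_, 'k) free_alg ring" by (rule ring_free_algebra)
  have "- f \<in> carrier (free_algebra S)"
    using assms by (simp add: free_algebra_def keys_uminus)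
  then show ?thesis
    using assms by (intro minus_equality) simp_all
qed

lemma free_algebra_closed:
  fixes f g :: "(_, 'k::field) free_alg"
  shows "f \<in> carrier (free_algebra S) \<Longrightarrow> g \<in> carrier (free_algebra S) \<Longrightarrow> f + g \<in> carrier (free_algebra S)"
    "f \<in> carrier (free_algebra S) \<Longrightarrow> g \<in> carrier (free_algebra S) \<Longrightarrow> f - g \<in> carrier (free_algebra S)"
    "f \<in> carrier (free_algebra S) \<Longrightarrow> g \<in> carrier (free_algebra S) \<Longrightarrow> f * g \<in> carrier (free_algebra S)"
    "1 \<in> carrier (free_algebra S :: (_, 'k) free_alg ring)"
    "fa_const c \<in> carrier (free_algebra S)"
    "a \<in> S \<Longrightarrow> fa_gen a \<in> carrier (free_algebra S :: (_, 'k) free_alg ring)"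
proof -
  interpret R: ring "free_algebra S :: (_, 'k) free_alg ring" by (rule ring_free_algebra)
  show "f + g \<in> carrier (free_algebra S)"
    if "f \<in> carrier (free_algebra S)" "g \<in> carrier (free_algebra S)"
    using R.a_closed[OF that] by simp
  show "f * g \<in> carrier (free_algebra S)"
    if "f \<in> carrier (free_algebra S)" "g \<in> carrier (free_algebra S)"
    using R.m_closed[OF that] by simp
  show "f - g \<in> carrier (free_algebra S)"
    if "f \<in> carrier (free_algebra S)" "g \<in> carrier (free_algebra S)"
    using R.minus_closed[OF that] that
    by (simp add: a_minus_def free_algebra_a_inv)
  show "1 \<in> carrier (free_algebra S :: (_, 'k) free_alg ring)"
    using R.one_closed by simp
qed (auto simp: free_algebra_def fa_const_def fa_gen_def zero_word_def)

lemma hecke_relators_closed: "hecke_relators q v n \<subseteq> carrier (free_algebra (hecke_gens n))"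
proof -
  have prod: "prod_list (map (\<lambda>j. fa_tau - fa_const (v j)) js) \<in> carrier (free_algebra (hecke_gens n))" for js
    by (induction js) (auto intro!: free_algebra_closed simp: hecke_gens_def)
  show ?thesis
    using prod
    by (auto simp: hecke_relators_def power2_eq_square intro!: free_algebra_closed)
       (auto simp: hecke_gens_def)
qed

text \<open>Linearity is stated for combinations over an index set, so that addition, the zero
  vector and scaling are the instances with two, no and one index.\<close>

lemma gen_action_sum:
  "gen_action q v n \<nu> g (\<lambda>Y. \<Sum>j\<in>J. c j * x j Y) = (\<lambda>Y. \<Sum>j\<in>J. c j * gen_action q v n \<nu> g (x j) Y)"
  unfolding gen_action_def
  by (simp add: sum_distrib_left sum_distrib_right mult.assoc)
     (intro ext, rule sum.swap)

lemma foldr_gen_action_sum: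
  "foldr (gen_action q v n \<nu>) ws (\<lambda>Y. \<Sum>j\<in>J. c j * x j Y)
    = (\<lambda>Y. \<Sum>j\<in>J. c j * foldr (gen_action q v n \<nu>) ws (x j) Y)"
  by (induction ws) (simp_all add: gen_action_sum)

lemma free_action_superset:
  assumes "finite A" "Poly_Mapping.keys f \<subseteq> A"
  shows "free_action q v n \<nu> f x
    = (\<lambda>Y. \<Sum>w\<in>A. Poly_Mapping.lookup f w * foldr (gen_action q v n \<nu>) (letters w) x Y)"
  unfolding free_action_def
  by (intro ext sum.mono_neutral_left) (use assms in \<open>auto simp: in_keys_iff\<close>)

lemma free_action_sum:
  "free_action q v n \<nu> f (\<lambda>Y. \<Sum>j\<in>J. c j * x j Y) = (\<lambda>Y. \<Sum>j\<in>J. c j * free_action q v n \<nu> f (x j) Y)"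
  unfolding free_action_def foldr_gen_action_sum
  by (simp add: sum_distrib_left mult.left_commute)
     (intro ext, rule sum.swap)

lemma free_action_vec_add:
  "free_action q v n \<nu> f (\<lambda>Y. x Y + y Y) = (\<lambda>Y. free_action q v n \<nu> f x Y + free_action q v n \<nu> f y Y)"
  using free_action_sum[of q v n \<nu> f "\<lambda>_. 1" "\<lambda>b. if b then x else y" UNIV]
  by (simp add: UNIV_bool add.commute)

lemma free_action_vec_zero: "free_action q v n \<nu> f (\<lambda>Y. 0) = (\<lambda>Y. 0)"
  using free_action_sum[of q v n \<nu> f "\<lambda>_. 0" "\<lambda>_. undefined" "{}"] by simp

lemma free_action_zero: "free_action q v n \<nu> 0 x = (\<lambda>Y. 0)"
  by (simp add: free_action_def)

lemma free_action_single:
  "free_action q v n \<nu> (Poly_Mapping.single w c) x = (\<lambda>Y. c * foldr (gen_action q v n \<nu>) (letters w) x Y)"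
  by (cases "c = 0") (simp_all add: free_action_def)

lemma free_action_gen: "free_action q v n \<nu> (fa_gen g) x = gen_action q v n \<nu> g x"
  by (simp add: fa_gen_def free_action_single)

lemma free_action_const: "free_action q v n \<nu> (fa_const c) x = (\<lambda>Y. c * x Y)"
  by (simp add: fa_const_def free_action_single zero_word_def)

lemma free_action_one: "free_action q v n \<nu> 1 x = x"
  using free_action_const[of q v n \<nu> 1 x] by (simp add: fa_const_def)

lemma free_action_add:
  "free_action q v n \<nu> (f + g) x = (\<lambda>Y. free_action q v n \<nu> f x Y + free_action q v n \<nu> g x Y)"
proof -
  let ?A = "Poly_Mapping.keys f \<union> Poly_Mapping.keys g"
  have "Poly_Mapping.keys (f + g) \<subseteq> ?A" by (rule keys_add)
  then show ?thesis
    by (simp add: free_action_superset[of ?A] lookup_add distrib_right sum.distrib)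
qed

lemma free_action_uminus: "free_action q v n \<nu> (- f) x = (\<lambda>Y. - free_action q v n \<nu> f x Y)"
  by (simp add: free_action_def keys_uminus sum_negf)

lemma free_action_diff:
  "free_action q v n \<nu> (f - g) x = (\<lambda>Y. free_action q v n \<nu> f x Y - free_action q v n \<nu> g x Y)"
  using free_action_add[of q v n \<nu> f "- g" x] by (simp add: free_action_uminus)

text \<open>\<open>foldr\<close> applies the last letter first, so concatenating words composes
  their actions; additivity in both factors reduces everything to single words.\<close>

lemma free_action_mult: "free_action q v n \<nu> (f * g) x = free_action q v n \<nu> f (free_action q v n \<nu> g x)"
proof (induction f rule: poly_mapping_add_induct)
  case zero
  then show ?case by (simp add: free_action_zero)
next
  case (add f1 f2)
  then show ?case by (simp add: free_action_add distrib_right)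
next
  case (single u a)
  show ?case
  proof (induction g rule: poly_mapping_add_induct)
    case zero
    then show ?case by (simp add: free_action_zero free_action_vec_zero)
  next
    case (add f1 f2)
    then show ?case by (simp add: free_action_add free_action_vec_add distrib_left)
  next
    case (single w b)
    have "foldr (gen_action q v n \<nu>) (letters u) (\<lambda>Y. b * z Y)
        = (\<lambda>Y. b * foldr (gen_action q v n \<nu>) (letters u) z Y)" for z
      using foldr_gen_action_sum[of q v n \<nu> "letters u" "\<lambda>_. b" "\<lambda>_. z" "{()}"] by simp
    then show ?case
      by (simp add: mult_single free_action_single plus_word_def mult.assoc)
  qed
qed

lemma gen_action_supported:
  assumes "Y \<notin> standard_mtableaux n \<nu>"
  shows "gen_action q v n \<nu> g x Y = 0"
  unfolding gen_action_def
proof (intro sum.neutral ballI)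
  fix X assume "X \<in> standard_mtableaux n \<nu>"
  then show "x X * gen_on_basis q v n \<nu> g X Y = 0"
    using assms by (cases g) (auto simp: basis_vec_def)
qed

lemma V_module_carrier:
  "x \<in> carrier (V_module q v n \<nu>) \<longleftrightarrow> (\<forall>X. X \<notin> standard_mtableaux n \<nu> \<longrightarrow> x X = 0)"
  by (simp add: V_module_def)

lemma V_module_simps [simp]:
  "x \<oplus>\<^bsub>V_module q v n \<nu>\<^esub> y = (\<lambda>X. x X + y X)" "\<zero>\<^bsub>V_module q v n \<nu>\<^esub> = (\<lambda>X. 0)"
  by (simp_all add: V_module_def)

lemma free_action_closed:
  assumes "x \<in> carrier (V_module q v n \<nu>)"
  shows "free_action q v n \<nu> f x \<in> carrier (V_module q v n \<nu>)"
proof -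
  have "foldr (gen_action q v n \<nu>) ws x Y = 0" if "Y \<notin> standard_mtableaux n \<nu>" for ws Y
    using that assms gen_action_supported by (cases ws) (auto simp: V_module_carrier)
  then show ?thesis
    by (simp add: V_module_carrier free_action_def)
qed

lemma abelian_group_V_module: "abelian_group (V_module q v n \<nu>)"
proof (rule abelian_groupI)
  fix x assume "x \<in> carrier (V_module q v n \<nu>)"
  then show "\<exists>y\<in>carrier (V_module q v n \<nu>). y \<oplus>\<^bsub>V_module q v n \<nu>\<^esub> x = \<zero>\<^bsub>V_module q v n \<nu>\<^esub>"
    by (intro bexI[of _ "\<lambda>Y. - x Y"]) (auto simp: V_module_carrier)
qed (auto simp: V_module_carrier algebra_simps)

section \<open>Descent of the action to the quotient by the relators\<close>

abbreviation hecke_ideal :: "'k::field \<Rightarrow> ('m::{finite,linorder} \<Rightarrow> 'k) \<Rightarrow> nat \<Rightarrow> (hecke_gen, 'k) free_alg set" where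
  "hecke_ideal q v n \<equiv> Idl\<^bsub>free_algebra (hecke_gens n)\<^esub> (hecke_relators q v n)"

abbreviation hecke_class ::
    "'k::field \<Rightarrow> ('m::{finite,linorder} \<Rightarrow> 'k) \<Rightarrow> nat \<Rightarrow> (hecke_gen, 'k) free_alg \<Rightarrow> (hecke_gen, 'k) free_alg set" where
  "hecke_class q v n f \<equiv> hecke_ideal q v n +>\<^bsub>free_algebra (hecke_gens n)\<^esub> f"

lemma ideal_hecke_ideal: "ideal (hecke_ideal q v n) (free_algebra (hecke_gens n))"
  using ring.genideal_ideal[OF ring_free_algebra hecke_relators_closed] .

text \<open>By minimality of the generated ideal, this reduces the vanishing of the whole of
  \<open>hecke_ideal\<close> to that of the relators. Closure under right factors uses that the
  action preserves the carrier.\<close>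

lemma ideal_annihilator:
  fixes q :: "'k::field" and S :: "hecke_gen set"
  defines "R \<equiv> free_algebra S :: (hecke_gen, 'k) free_alg ring"
  shows "ideal {f \<in> carrier R. \<forall>x\<in>carrier (V_module q v n \<nu>). free_action q v n \<nu> f x = (\<lambda>Y. 0)} R"
proof -
  interpret ring R unfolding R_def by (rule ring_free_algebra)
  let ?I = "{f \<in> carrier R. \<forall>x\<in>carrier (V_module q v n \<nu>). free_action q v n \<nu> f x = (\<lambda>Y. 0)}"
  show ?thesis
  proof (rule idealI)
    show "subgroup ?I (add_monoid R)"
    proof
      fix x assume x: "x \<in> ?I"
      have "inv\<^bsub>add_monoid R\<^esub> x = - x"
        using x free_algebra_a_inv[of x S] by (simp add: R_def a_inv_def)
      moreover have "- x \<in> carrier R"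
        using x by (simp add: R_def free_algebra_def keys_uminus)
      ultimately show "inv\<^bsub>add_monoid R\<^esub> x \<in> ?I"
        using x by (simp add: free_action_uminus)
    next
      show "\<one>\<^bsub>add_monoid R\<^esub> \<in> ?I"
        using zero_closed by (simp add: R_def free_action_zero)
    next
      fix x y assume "x \<in> ?I" "y \<in> ?I"
      then show "x \<otimes>\<^bsub>add_monoid R\<^esub> y \<in> ?I"
        using free_algebra_closed(1)[of x S y] by (simp add: R_def free_action_add)
    qed auto
  next
    fix a x assume "a \<in> ?I" "x \<in> carrier R"
    then show "x \<otimes>\<^bsub>R\<^esub> a \<in> ?I" "a \<otimes>\<^bsub>R\<^esub> x \<in> ?I"
      by (simp_all add: R_def free_algebra_closed free_action_mult free_action_vec_zero free_action_closed)
  qed (rule ring_axioms)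
qed

lemma hecke_ideal_acts_zero:
  assumes "\<And>f x. f \<in> hecke_relators q v n \<Longrightarrow> x \<in> carrier (V_module q v n \<nu>) \<Longrightarrow>
      free_action q v n \<nu> f x = (\<lambda>Y. 0)"
    and "f \<in> hecke_ideal q v n" "x \<in> carrier (V_module q v n \<nu>)"
  shows "free_action q v n \<nu> f x = (\<lambda>Y. 0)"
proof -
  have "hecke_ideal q v n \<subseteq> {f \<in> carrier (free_algebra (hecke_gens n)).
      \<forall>x\<in>carrier (V_module q v n \<nu>). free_action q v n \<nu> f x = (\<lambda>Y. 0)}"
    using assms(1) hecke_relators_closed[of q v n]
    by (intro ring.genideal_minimal ring_free_algebra ideal_annihilator) auto
  then show ?thesis using assms(2,3) by blast
qed

text \<open>Two representatives of a coset differ by an element that acts as zero, so the set to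
  which \<open>V_module\<close> applies \<open>the_elem\<close> is a singleton.\<close>

lemma hecke_smult:
  assumes "\<And>f x. f \<in> hecke_relators q v n \<Longrightarrow> x \<in> carrier (V_module q v n \<nu>) \<Longrightarrow>
      free_action q v n \<nu> f x = (\<lambda>Y. 0)"
    and "f \<in> carrier (free_algebra (hecke_gens n))" "x \<in> carrier (V_module q v n \<nu>)"
  shows "hecke_class q v n f \<odot>\<^bsub>V_module q v n \<nu>\<^esub> x = free_action q v n \<nu> f x"
proof -
  interpret ideal "hecke_ideal q v n" "free_algebra (hecke_gens n)" by (rule ideal_hecke_ideal)
  have "f \<in> hecke_class q v n f" using assms(2) by (rule a_rcos_self)
  moreover have "free_action q v n \<nu> g x \<in> {free_action q v n \<nu> f x}" if "g \<in> hecke_class q v n f" for g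
  proof -
    from that obtain h where "h \<in> hecke_ideal q v n" "g = h + f"
      by (auto simp: a_r_coset_def')
    moreover from assms(1) this(1) assms(3) have "free_action q v n \<nu> h x = (\<lambda>Y. 0)"
      by (rule hecke_ideal_acts_zero)
    ultimately show ?thesis by (simp add: free_action_add)
  qed
  ultimately have "(\<lambda>f. free_action q v n \<nu> f x) ` hecke_class q v n f = {free_action q v n \<nu> f x}"
    by blast
  then show ?thesis by (simp add: V_module_def)
qed

lemma carrier_hecke_algebra:
  "carrier (hecke_algebra q v n) = hecke_class q v n ` carrier (free_algebra (hecke_gens n))"
  by (auto simp: hecke_algebra_def FactRing_def A_RCOSETS_def')

lemma left_module_V_module:
  assumes rel: "\<And>f x. f \<in> hecke_relators q v n \<Longrightarrow> x \<in> carrier (V_module q v n \<nu>) \<Longrightarrow>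
      free_action q v n \<nu> f x = (\<lambda>Y. 0)"
  shows "left_module (hecke_algebra q v n) (V_module q v n \<nu>)"
proof -
  interpret I: ideal "hecke_ideal q v n" "free_algebra (hecke_gens n)" by (rule ideal_hecke_ideal)
  interpret H: ring "hecke_algebra q v n"
    unfolding hecke_algebra_def by (rule I.quotient_is_ring)
  interpret V: abelian_group "V_module q v n \<nu>" by (rule abelian_group_V_module)
  have hom: "hecke_class q v n f \<oplus>\<^bsub>hecke_algebra q v n\<^esub> hecke_class q v n g = hecke_class q v n (f + g)"
    "hecke_class q v n f \<otimes>\<^bsub>hecke_algebra q v n\<^esub> hecke_class q v n g = hecke_class q v n (f * g)"
    if "f \<in> carrier (free_algebra (hecke_gens n))" "g \<in> carrier (free_algebra (hecke_gens n))" for f g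
    using ring_hom_add[OF I.rcos_ring_hom that] ring_hom_mult[OF I.rcos_ring_hom that]
    unfolding hecke_algebra_def free_algebra_simps by simp_all
  have one: "\<one>\<^bsub>hecke_algebra q v n\<^esub> = hecke_class q v n 1"
    using ring_hom_one[OF I.rcos_ring_hom] unfolding hecke_algebra_def free_algebra_simps by simp
  have smult: "hecke_class q v n f \<odot>\<^bsub>V_module q v n \<nu>\<^esub> x = free_action q v n \<nu> f x"
    if "f \<in> carrier (free_algebra (hecke_gens n))" "x \<in> carrier (V_module q v n \<nu>)" for f x
    using rel that by (rule hecke_smult)
  show ?thesis
  proof
    fix a x assume a: "a \<in> carrier (hecke_algebra q v n)" and x: "x \<in> carrier (V_module q v n \<nu>)"
    from a obtain f where f: "f \<in> carrier (free_algebra (hecke_gens n))" "a = hecke_class q v n f"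
      by (auto simp: carrier_hecke_algebra)
    show "a \<odot>\<^bsub>V_module q v n \<nu>\<^esub> x \<in> carrier (V_module q v n \<nu>)"
      using f x by (simp add: smult free_action_closed)
    fix y assume y: "y \<in> carrier (V_module q v n \<nu>)"
    then show "a \<odot>\<^bsub>V_module q v n \<nu>\<^esub> (x \<oplus>\<^bsub>V_module q v n \<nu>\<^esub> y) =
      a \<odot>\<^bsub>V_module q v n \<nu>\<^esub> x \<oplus>\<^bsub>V_module q v n \<nu>\<^esub> a \<odot>\<^bsub>V_module q v n \<nu>\<^esub> y"
      using f x y V.a_closed[OF x y] by (simp add: smult free_action_vec_add)
  next
    fix a b x assume ab: "a \<in> carrier (hecke_algebra q v n)" "b \<in> carrier (hecke_algebra q v n)"
      and x: "x \<in> carrier (V_module q v n \<nu>)"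
    from ab obtain f g where fg: "f \<in> carrier (free_algebra (hecke_gens n))" "a = hecke_class q v n f"
      "g \<in> carrier (free_algebra (hecke_gens n))" "b = hecke_class q v n g"
      by (auto simp: carrier_hecke_algebra)
    show "(a \<oplus>\<^bsub>hecke_algebra q v n\<^esub> b) \<odot>\<^bsub>V_module q v n \<nu>\<^esub> x =
      a \<odot>\<^bsub>V_module q v n \<nu>\<^esub> x \<oplus>\<^bsub>V_module q v n \<nu>\<^esub> b \<odot>\<^bsub>V_module q v n \<nu>\<^esub> x"
      using fg x by (simp add: hom smult free_algebra_closed free_action_add)
    show "(a \<otimes>\<^bsub>hecke_algebra q v n\<^esub> b) \<odot>\<^bsub>V_module q v n \<nu>\<^esub> x =
      a \<odot>\<^bsub>V_module q v n \<nu>\<^esub> (b \<odot>\<^bsub>V_module q v n \<nu>\<^esub> x)"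
      using fg x by (simp add: hom smult free_algebra_closed free_action_mult free_action_closed)
  next
    fix x assume "x \<in> carrier (V_module q v n \<nu>)"
    then show "\<one>\<^bsub>hecke_algebra q v n\<^esub> \<odot>\<^bsub>V_module q v n \<nu>\<^esub> x = x"
      by (simp add: one smult free_algebra_closed free_action_one)
  qed
qed

section \<open>Combinatorics of standard tableaux\<close>

text \<open>Unlike the standard tableaux these are closed under exchanging consecutive entries, so a
  product of several \<sigma>'s can be evaluated without asking which intermediate tableaux are
  standard.\<close>

definition fillings :: "nat \<Rightarrow> ('m \<Rightarrow> nat list) \<Rightarrow> 'm mtableau set" where
  "fillings n \<nu> = {X \<in> mnodes \<nu> \<rightarrow>\<^sub>E {1..n}. bij_betw X (mnodes \<nu>) {1..n}}"

text \<open>The standard tableaux are the fillings that increase strictly for this order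
  (\<open>standard_mono\<close>, \<open>standardI\<close>).\<close>

definition node_le :: "'m mnode \<Rightarrow> 'm mnode \<Rightarrow> bool" where
  "node_le = (\<lambda>(k, r, s) (k', r', s'). k = k' \<and> r \<le> r' \<and> s \<le> s')"

definition node_adj :: "'m mnode \<Rightarrow> 'm mnode \<Rightarrow> bool" where
  "node_adj = (\<lambda>(k, r, s) (k', r', s'). k = k' \<and> (r = r' \<and> s' = Suc s \<or> r' = Suc r \<and> s = s'))"

text \<open>Not the hook of the hook length formula, but a supply of nodes for counting: all of them
  precede the given node, hence carry smaller entries in a standard tableau, and their number
  controls its diagonal.\<close>

definition hook :: "'m mnode \<Rightarrow> 'm mnode set" where
  "hook = (\<lambda>(k, r, s). (\<lambda>j. (k, 1, j)) ` {1..<s} \<union> (\<lambda>j. (k, j, 1)) ` {1..<r})"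

section \<open>Diagrams of multipartitions\<close>

lemma mnodes_conv_Sigma:
  "mnodes \<nu> = (SIGMA k:UNIV. SIGMA r:{1..length (\<nu> k)}. {1..\<nu> k ! (r - 1)})"
  by (auto simp: mnodes_def)

lemma finite_mnodes: "finite (mnodes (\<nu> :: 'm::finite \<Rightarrow> nat list))"
  unfolding mnodes_conv_Sigma by (intro finite_SigmaI) auto

lemma card_mnodes:
  fixes \<nu> :: "'m::finite \<Rightarrow> nat list"
  assumes "\<nu> \<in> multipartitions n"
  shows "card (mnodes \<nu>) = n"
proof -
  have "(\<Sum>r\<in>{1..length p}. p ! (r - 1)) = sum_list p" for p :: "nat list"
    by (simp add: sum_list_sum_nth atLeast0LessThan sum.atLeast1_atMost_eq)
  then have "card (mnodes \<nu>) = (\<Sum>k\<in>UNIV. sum_list (\<nu> k))"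
    unfolding mnodes_conv_Sigma by (subst card_SigmaI; simp)
  with assms show ?thesis by (simp add: multipartitions_def)
qed

lemma mnodes_positive: "(k, r, s) \<in> mnodes \<nu> \<Longrightarrow> 1 \<le> r \<and> 1 \<le> s"
  by (simp add: mnodes_def)

lemma mnodes_down_closed:
  assumes \<nu>: "\<nu> \<in> multipartitions n" and b: "(k, r, s) \<in> mnodes \<nu>"
    and "1 \<le> r'" "r' \<le> r" "1 \<le> s'" "s' \<le> s"
  shows "(k, r', s') \<in> mnodes \<nu>"
proof -
  have "\<nu> k ! (r - 1) \<le> \<nu> k ! (r' - 1)"
  proof (cases "r' = r")
    case False
    have "sorted_wrt (\<ge>) (\<nu> k)"
      using \<nu> by (simp add: multipartitions_def is_partition_def)
    then show ?thesis
      using False assms by (auto simp: sorted_wrt_iff_nth_less mnodes_def)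
  qed simp
  then show ?thesis using assms by (auto simp: mnodes_def)
qed

text \<open>Since no part is zero, each row shows up by its node in column 1; this recovers the
  number of rows, and the nodes of a row recover its length.\<close>

lemma mnodes_inject:
  assumes "\<nu> \<in> multipartitions n" "\<mu> \<in> multipartitions m" "mnodes \<nu> = mnodes \<mu>"
  shows "\<nu> = \<mu>"
proof
  fix k
  have part: "is_partition (\<nu> k)" "is_partition (\<mu> k)"
    using assms(1,2) by (auto simp: multipartitions_def)
  have rows: "1 \<le> r \<and> r \<le> length p \<longleftrightarrow> 1 \<le> r \<and> r \<le> length p \<and> 1 \<le> p ! (r - 1)"
    if "is_partition p" for p r
    using that by (auto simp: is_partition_def Suc_le_eq) (metis One_nat_def Suc_le_D diff_Suc_1' not_gr_zero nth_mem Suc_le_eq)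
  have mem: "(k, r, s) \<in> mnodes \<nu> \<longleftrightarrow> (k, r, s) \<in> mnodes \<mu>" for r s
    using assms(3) by simp
  have "r \<in> {1..length (\<nu> k)} \<longleftrightarrow> r \<in> {1..length (\<mu> k)}" for r
    using mem[of r 1] rows[OF part(1), of r] rows[OF part(2), of r] by (simp add: mnodes_def)
  then have "{1..length (\<nu> k)} = {1..length (\<mu> k)}" by blast
  then have len: "length (\<nu> k) = length (\<mu> k)"
    by (metis card_atLeastAtMost diff_Suc_1)
  show "\<nu> k = \<mu> k"
  proof (rule nth_equalityI[OF len])
    fix i assume i: "i < length (\<nu> k)"
    have "s \<in> {1..\<nu> k ! i} \<longleftrightarrow> s \<in> {1..\<mu> k ! i}" for s
      using mem[of "Suc i" s] i len by (simp add: mnodes_def)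
    then have "{1..\<nu> k ! i} = {1..\<mu> k ! i}" by blast
    then show "\<nu> k ! i = \<mu> k ! i"
      by (metis card_atLeastAtMost diff_Suc_1)
  qed
qed

section \<open>Fillings and the exchange of consecutive entries\<close>

lemma standard_in_fillings: "X \<in> standard_mtableaux n \<nu> \<Longrightarrow> X \<in> fillings n \<nu>"
  by (simp add: standard_mtableaux_def fillings_def)

lemma finite_standard_mtableaux:
  "finite (standard_mtableaux n (\<nu> :: 'm::finite \<Rightarrow> nat list))"
proof (rule finite_subset)
  show "standard_mtableaux n \<nu> \<subseteq> mnodes \<nu> \<rightarrow>\<^sub>E {1..n}"
    by (auto simp: standard_mtableaux_def)
qed (intro finite_PiE finite_mnodes, auto)

lemma fillings_bij: "X \<in> fillings n \<nu> \<Longrightarrow> bij_betw X (mnodes \<nu>) {1..n}"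
  by (simp add: fillings_def)

lemma node_of_in:
  assumes "X \<in> fillings n \<nu>" "i \<in> {1..n}"
  shows "node_of \<nu> X i \<in> mnodes \<nu>" "X (node_of \<nu> X i) = i"
  using fillings_bij[OF assms(1)] assms(2) unfolding node_of_def
  by (metis bij_betw_def inv_into_into, metis bij_betw_def f_inv_into_f)

lemma node_of_eq:
  assumes "X \<in> fillings n \<nu>" "b \<in> mnodes \<nu>"
  shows "X b \<in> {1..n}" "node_of \<nu> X (X b) = b"
  using fillings_bij[OF assms(1)] assms(2) unfolding node_of_def
  by (auto simp: bij_betw_def)

lemma node_of_inject:
  assumes "X \<in> fillings n \<nu>" "i \<in> {1..n}" "j \<in> {1..n}"
  shows "node_of \<nu> X i = node_of \<nu> X j \<longleftrightarrow> i = j"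
  using node_of_in(2)[OF assms(1)] assms(2,3) by metis

lemma node_of_image:
  assumes "X \<in> fillings n \<nu>"
  shows "node_of \<nu> X ` {1..n} = mnodes \<nu>"
proof
  show "node_of \<nu> X ` {1..n} \<subseteq> mnodes \<nu>" using node_of_in(1)[OF assms] by blast
  show "mnodes \<nu> \<subseteq> node_of \<nu> X ` {1..n}" using node_of_eq[OF assms] by (metis image_eqI subsetI)
qed

lemma fillings_eqI:
  assumes "X \<in> fillings n \<nu>" "Y \<in> fillings n \<nu>"
    and "\<And>i. i \<in> {1..n} \<Longrightarrow> node_of \<nu> X i = node_of \<nu> Y i"
  shows "X = Y"
proof
  fix b
  show "X b = Y b"
  proof (cases "b \<in> mnodes \<nu>")
    case True
    then show ?thesis
      using assms node_of_eq[OF assms(1) True] node_of_in(2)[OF assms(2)] by metis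
  next
    case False
    then show ?thesis
      using assms(1,2) PiE_arb[of X "mnodes \<nu>" "\<lambda>_. {1..n}" b] PiE_arb[of Y "mnodes \<nu>" "\<lambda>_. {1..n}" b]
      by (simp add: fillings_def)
  qed
qed

lemma transpose_Suc_mem:
  "1 \<le> i \<Longrightarrow> i < n \<Longrightarrow> j \<in> {1..n::nat} \<Longrightarrow> transpose i (i + 1) j \<in> {1..n}"
  by (cases "j = i"; cases "j = i + 1") auto

lemma swap_entries_fillings:
  assumes "X \<in> fillings n \<nu>" "1 \<le> i" "i < n"
  shows "swap_entries \<nu> i X \<in> fillings n \<nu>"
proof -
  have "bij_betw (transpose i (i + 1)) {1..n} {1..n}"
    using assms by (intro bij_betw_byWitness[of _ "transpose i (i + 1)"]) (auto simp: transpose_def)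
  from bij_betw_trans[OF fillings_bij[OF assms(1)] this]
  have "bij_betw (swap_entries \<nu> i X) (mnodes \<nu>) {1..n}"
    by (subst bij_betw_cong[of _ _ "transpose i (i + 1) \<circ> X"]) (auto simp: swap_entries_def)
  moreover have "swap_entries \<nu> i X \<in> mnodes \<nu> \<rightarrow>\<^sub>E {1..n}"
    using node_of_eq(1)[OF assms(1)] transpose_Suc_mem[OF assms(2,3)]
    by (simp add: swap_entries_def)
  ultimately show ?thesis by (simp add: fillings_def)
qed

lemma node_of_swap_entries:
  assumes "X \<in> fillings n \<nu>" "1 \<le> i" "i < n" "j \<in> {1..n}"
  shows "node_of \<nu> (swap_entries \<nu> i X) j = node_of \<nu> X (transpose i (i + 1) j)"
proof -
  let ?b = "node_of \<nu> X (transpose i (i + 1) j)"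
  have b: "?b \<in> mnodes \<nu>" "X ?b = transpose i (i + 1) j"
    using node_of_in[OF assms(1) transpose_Suc_mem[OF assms(2-4)]] by auto
  then have "swap_entries \<nu> i X ?b = j"
    by (simp add: swap_entries_def)
  then show ?thesis
    using node_of_eq(2)[OF swap_entries_fillings[OF assms(1-3)] b(1)] by simp
qed

lemma node_of_swap_entries_simps:
  assumes "X \<in> fillings n \<nu>" "1 \<le> i" "i < n"
  shows "node_of \<nu> (swap_entries \<nu> i X) i = node_of \<nu> X (i + 1)"
    "node_of \<nu> (swap_entries \<nu> i X) (i + 1) = node_of \<nu> X i"
    "j \<in> {1..n} \<Longrightarrow> j \<noteq> i \<Longrightarrow> j \<noteq> i + 1 \<Longrightarrow> node_of \<nu> (swap_entries \<nu> i X) j = node_of \<nu> X j"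
  using assms by (simp_all add: node_of_swap_entries)

lemma swap_entries_swap_entries:
  assumes "X \<in> fillings n \<nu>"
  shows "swap_entries \<nu> i (swap_entries \<nu> i X) = X"
  using assms by (auto simp: swap_entries_def fillings_def PiE_def extensional_def)

lemma swap_entries_commute:
  assumes "\<bar>int i - int j\<bar> > 1"
  shows "swap_entries \<nu> i (swap_entries \<nu> j X) = swap_entries \<nu> j (swap_entries \<nu> i X)"
  unfolding swap_entries_def
  by (rule ext) (use assms in \<open>auto simp: restrict_def transpose_def\<close>)

lemma swap_entries_braid:
  "swap_entries \<nu> i (swap_entries \<nu> (i + 1) (swap_entries \<nu> i X)) =
   swap_entries \<nu> (i + 1) (swap_entries \<nu> i (swap_entries \<nu> (i + 1) X))"
  unfolding swap_entries_def
  by (rule ext) (auto simp: restrict_def transpose_def)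

lemma standard_mono:
  assumes \<nu>: "\<nu> \<in> multipartitions n" and X: "X \<in> standard_mtableaux n \<nu>"
    and b: "b \<in> mnodes \<nu>" "b' \<in> mnodes \<nu>" "node_le b b'" "b \<noteq> b'"
  shows "X b < X b'"
proof -
  obtain k r s r' s' where [simp]: "b = (k, r, s)" "b' = (k, r', s')" and le: "r \<le> r'" "s \<le> s'"
    using b(3) by (auto simp: node_le_def)
  \<comment> \<open>The corner in the row of \<open>b\<close> and the column of \<open>b'\<close>
    belongs to the diagram, so one goes along the row to it and then down the column.\<close>
  have mid: "(k, r, s') \<in> mnodes \<nu>"
    using mnodes_down_closed[OF \<nu>, of k r' s' r s'] b(1,2) le mnodes_positive[of k r s \<nu>]
      mnodes_positive[of k r' s' \<nu>] by simp
  have "X (k, r, s) < X (k, r, s')" if "s < s'"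
    using X b mid that by (simp add: standard_mtableaux_def)
  moreover have "X (k, r, s') < X (k, r', s')" if "r < r'"
    using X b mid that by (simp add: standard_mtableaux_def)
  ultimately show ?thesis
    using le b(4) by (cases "s = s'"; cases "r = r'") auto
qed

lemma standardI:
  assumes "X \<in> fillings n \<nu>"
    and "\<And>b b'. b \<in> mnodes \<nu> \<Longrightarrow> b' \<in> mnodes \<nu> \<Longrightarrow> node_le b b' \<Longrightarrow> b \<noteq> b' \<Longrightarrow> X b < X b'"
  shows "X \<in> standard_mtableaux n \<nu>"
  using assms by (auto simp: standard_mtableaux_def fillings_def node_le_def)

text \<open>Exchanging i and i + 1 changes the relative order of no other pair of entries, so only
  the two nodes carrying them can obstruct standardness.\<close>

lemma swap_entries_standard_iff:
  assumes \<nu>: "\<nu> \<in> multipartitions n" and X: "X \<in> standard_mtableaux n \<nu>" and i: "1 \<le> i" "i < n"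
  shows "swap_entries \<nu> i X \<in> standard_mtableaux n \<nu>
    \<longleftrightarrow> \<not> node_le (node_of \<nu> X i) (node_of \<nu> X (i + 1))"
proof -
  let ?x = "node_of \<nu> X i" and ?y = "node_of \<nu> X (i + 1)"
  note XF = standard_in_fillings[OF X]
  have x: "?x \<in> mnodes \<nu>" "X ?x = i" and y: "?y \<in> mnodes \<nu>" "X ?y = i + 1"
    using node_of_in[OF XF] i by auto
  show ?thesis
  proof
    assume S: "swap_entries \<nu> i X \<in> standard_mtableaux n \<nu>"
    have "\<not> swap_entries \<nu> i X ?x < swap_entries \<nu> i X ?y"
      using x y by (simp add: swap_entries_def)
    moreover have "?x \<noteq> ?y" using x y by auto
    ultimately show "\<not> node_le ?x ?y"
      using standard_mono[OF \<nu> S x(1) y(1)] by blast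
  next
    assume not_le: "\<not> node_le ?x ?y"
    show "swap_entries \<nu> i X \<in> standard_mtableaux n \<nu>"
    proof (rule standardI[OF swap_entries_fillings[OF XF i]])
      fix b b' assume b: "b \<in> mnodes \<nu>" "b' \<in> mnodes \<nu>" "node_le b b'" "b \<noteq> b'"
      have "X b < X b'" using standard_mono[OF \<nu> X b] .
      moreover have "\<not> (X b = i \<and> X b' = i + 1)"
        using not_le b node_of_eq(2)[OF XF] by metis
      ultimately show "swap_entries \<nu> i X b < swap_entries \<nu> i X b'"
        using b by (auto simp: swap_entries_def transpose_def)
    qed
  qed
qed

text \<open>A third node between the two would need an entry strictly between consecutive integers.
  The upper or left neighbour of \<open>b'\<close> is such a node unless it is \<open>b\<close>
  itself.\<close>

lemma consecutive_le_imp_adj: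
  assumes \<nu>: "\<nu> \<in> multipartitions n" and X: "X \<in> standard_mtableaux n \<nu>"
    and b: "b \<in> mnodes \<nu>" "b' \<in> mnodes \<nu>" "node_le b b'" and consec: "X b' = X b + 1"
  shows "node_adj b b'"
proof -
  obtain k r s r' s' where [simp]: "b = (k, r, s)" "b' = (k, r', s')" and le: "r \<le> r'" "s \<le> s'"
    using b(3) by (auto simp: node_le_def)
  have no_mid: "c = b \<or> c = b'" if "c \<in> mnodes \<nu>" "node_le b c" "node_le c b'" for c
  proof (rule ccontr)
    assume "\<not> (c = b \<or> c = b')"
    then have "X b < X c" "X c < X b'"
      using standard_mono[OF \<nu> X b(1) that(1,2)] standard_mono[OF \<nu> X that(1) b(2) that(3)] by auto
    then show False using consec by simp
  qed
  have pos: "1 \<le> r" "1 \<le> s" using mnodes_positive[of k r s \<nu>] b(1) by auto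
  show ?thesis
  proof (cases "r < r'")
    case True
    then have "(k, r' - 1, s') \<in> mnodes \<nu>"
      using mnodes_down_closed[OF \<nu>, of k r' s'] b(2) pos le by simp
    moreover have "r \<le> r' - 1" "r' - 1 \<noteq> r'" using True by auto
    ultimately have "r' - 1 = r \<and> s' = s"
      using no_mid[of "(k, r' - 1, s')"] le by (simp add: node_le_def)
    with True show ?thesis by (auto simp: node_adj_def)
  next
    case False
    then have [simp]: "r' = r" using le by simp
    have "s < s'" using le consec by (cases "s = s'") auto
    then have "(k, r, s' - 1) \<in> mnodes \<nu>"
      using mnodes_down_closed[OF \<nu>, of k r' s'] b(2) pos le by simp
    moreover have "s \<le> s' - 1" "s' - 1 \<noteq> s'" using \<open>s < s'\<close> by auto
    ultimately have "s' - 1 = s"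
      using no_mid[of "(k, r, s' - 1)"] by (simp add: node_le_def)
    with \<open>s < s'\<close> show ?thesis by (auto simp: node_adj_def)
  qed
qed

lemma hook_standard:
  assumes \<nu>: "\<nu> \<in> multipartitions n" and X: "X \<in> standard_mtableaux n \<nu>" and i: "i \<in> {1..n}"
  shows "hook (node_of \<nu> X i) \<subseteq> node_of \<nu> X ` {1..<i}"
proof
  fix b assume b: "b \<in> hook (node_of \<nu> X i)"
  note XF = standard_in_fillings[OF X]
  obtain k r s where x: "node_of \<nu> X i = (k, r, s)" by (metis prod_cases3)
  have xm: "(k, r, s) \<in> mnodes \<nu>" "X (k, r, s) = i"
    using node_of_in[OF XF i] x by auto
  note pos = mnodes_positive[OF xm(1)]
  have "b \<in> mnodes \<nu>" "node_le b (k, r, s)" "b \<noteq> (k, r, s)"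
    using b x pos mnodes_down_closed[OF \<nu> xm(1)] by (auto simp: hook_def node_le_def)
  with standard_mono[OF \<nu> X _ xm(1)] xm(2) have "X b < i" "b \<in> mnodes \<nu>" by auto
  then show "b \<in> node_of \<nu> X ` {1..<i}"
    using node_of_eq[OF XF] by (metis atLeastAtMost_iff atLeastLessThan_iff image_eqI)
qed

section \<open>Bounding diagonals by counting hook nodes\<close>

lemma card_hook_arms:
  "card ((\<lambda>j. (k::'m, 1::nat, j::nat)) ` {1..<s} \<union> (\<lambda>j. (k, j, 1)) ` {2..<r}) = (s - 1) + (r - 2)"
proof -
  have "card ((\<lambda>j. (k::'m, 1::nat, j::nat)) ` {1..<s}) = s - 1"
    by (subst card_image) (auto simp: inj_on_def)
  moreover have "card ((\<lambda>j. (k::'m, j::nat, 1::nat)) ` {2..<r}) = r - 2"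
    by (subst card_image) (auto simp: inj_on_def)
  ultimately show ?thesis
    by (subst card_Un_disjoint) auto
qed

text \<open>For x = (k, r, s) and y = (k, r', s') the difference is at most (s - 1) + (r' - 1), the
  lengths of the row arm of x and the column arm of y. Both lie in \<open>S\<close> and share at
  most the corner (k, 1, 1), which accounts for the + 1.\<close>

lemma hook_diag_same_component:
  assumes "finite S" "hook x \<subseteq> S" "hook y \<subseteq> S" "fst x = fst y"
    "1 \<le> fst (snd x)" "1 \<le> snd (snd x)" "1 \<le> fst (snd y)" "1 \<le> snd (snd y)"
  shows "\<bar>node_diag x - node_diag y\<bar> \<le> int (card S) + 1"
proof -
  have le: "node_diag x - node_diag y \<le> int (card S) + 1"
    if "hook x \<subseteq> S" "hook y \<subseteq> S" "fst x = fst y" "1 \<le> fst (snd x)" "1 \<le> snd (snd x)"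
      "1 \<le> fst (snd y)" "1 \<le> snd (snd y)" for x y :: "'a mnode"
  proof -
    obtain k r s r' s' where xy: "x = (k, r, s)" "y = (k, r', s')"
      using \<open>fst x = fst y\<close> by (metis fst_conv prod_cases3)
    have "(\<lambda>j. (k, 1::nat, j::nat)) ` {1..<s} \<union> (\<lambda>j. (k, j, 1)) ` {2..<r'} \<subseteq> S"
      using that xy by (auto simp: hook_def)
    from card_mono[OF assms(1) this] show ?thesis
      using that unfolding card_hook_arms by (auto simp: xy node_diag_def)
  qed
  show ?thesis
    using le[of x y] le[of y x] assms by simp
qed

lemma abs_diag_le_card_hook:
  assumes "1 \<le> r" "1 \<le> s"
  shows "\<bar>node_diag (k, r, s)\<bar> \<le> int (card (hook (k, r, s)))" "finite (hook (k, r, s))"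
proof -
  show fin: "finite (hook (k, r, s))" by (simp add: hook_def)
  \<comment> \<open>The empty range \<open>{2..<1}\<close> lets \<open>card_hook_arms\<close> count
    the row arm alone.\<close>
  have "(\<lambda>j. (k, 1::nat, j::nat)) ` {1..<s} \<union> (\<lambda>j. (k, j, 1)) ` {2..<1} \<subseteq> hook (k, r, s)"
    by (auto simp: hook_def)
  from card_mono[OF fin this] have "s - 1 \<le> card (hook (k, r, s))"
    unfolding card_hook_arms by simp
  moreover have "card ((\<lambda>j. (k, j::nat, 1::nat)) ` {1..<r}) = r - 1"
    by (subst card_image) (auto simp: inj_on_def)
  then have "r - 1 \<le> card (hook (k, r, s))"
    using card_mono[OF fin, of "(\<lambda>j. (k, j::nat, 1::nat)) ` {1..<r}"] by (auto simp: hook_def)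
  ultimately show "\<bar>node_diag (k, r, s)\<bar> \<le> int (card (hook (k, r, s)))"
    using assms by (auto simp: node_diag_def)
qed

text \<open>Hooks in different components are disjoint, so each diagonal is paid for by its own
  nodes. There is no + 1 as in the case of one component, and none can be afforded, because
  \<open>cross\<close> only covers exponents strictly below \<open>n\<close>.\<close>

lemma hook_diag_distinct_components:
  assumes "finite S" "hook x \<subseteq> S" "hook y \<subseteq> S" "fst x \<noteq> fst y"
    "1 \<le> fst (snd x)" "1 \<le> snd (snd x)" "1 \<le> fst (snd y)" "1 \<le> snd (snd y)"
  shows "\<bar>node_diag x\<bar> + \<bar>node_diag y\<bar> \<le> int (card S)"
proof -
  have "hook x \<inter> hook y = {}"
    using assms(4) by (auto simp: hook_def split: prod.splits)
  then have "card (hook x) + card (hook y) \<le> card S"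
    using assms(1-3) by (metis card_Un_disjoint card_mono finite_subset Un_least)
  moreover have "\<bar>node_diag x\<bar> \<le> int (card (hook x))" "\<bar>node_diag y\<bar> \<le> int (card (hook y))"
    using assms(5-8) abs_diag_le_card_hook(1)[of "fst (snd x)" "snd (snd x)" "fst x"]
      abs_diag_le_card_hook(1)[of "fst (snd y)" "snd (snd y)" "fst y"] by simp_all
  ultimately show ?thesis by simp
qed

lemma node_of_positive:
  assumes "X \<in> fillings n \<nu>" "i \<in> {1..n}"
  shows "1 \<le> fst (snd (node_of \<nu> X i))" "1 \<le> snd (snd (node_of \<nu> X i))"
  using node_of_in(1)[OF assms] mnodes_positive by (metis prod.collapse)+

text \<open>On a common diagonal the two nodes are opposite corners of a rectangle in the diagram
  whose other two corners carry distinct entries in between, so the entries would differ by at least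
  3. A distance of up to 2 covers all pairs that occur in the braid relation.\<close>

lemma near_entries_distinct_diag:
  assumes \<nu>: "\<nu> \<in> multipartitions n" and X: "X \<in> standard_mtableaux n \<nu>"
    and b: "b \<in> mnodes \<nu>" "b' \<in> mnodes \<nu>" and near: "X b < X b'" "X b' \<le> X b + 2"
    and "fst b = fst b'"
  shows "node_diag b \<noteq> node_diag b'"
proof
  assume diag: "node_diag b = node_diag b'"
  obtain k r s r' s' where [simp]: "b = (k, r, s)" "b' = (k, r', s')"
    using assms(7) by (metis fst_conv prod_cases3)
  have pos: "1 \<le> r" "1 \<le> s" "1 \<le> r'" "1 \<le> s'"
    using b mnodes_positive[of k r s] mnodes_positive[of k r' s'] by auto
  have "r \<noteq> r'" using diag near by (auto simp: node_diag_def)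
  moreover have "\<not> r' < r"
  proof
    assume "r' < r"
    then have "node_le b' b" "b' \<noteq> b" using diag by (auto simp: node_le_def node_diag_def)
    from standard_mono[OF \<nu> X b(2,1) this] near show False by simp
  qed
  ultimately have lt: "r < r'" "s < s'" using diag by (auto simp: node_diag_def)
  have m: "(k, r, s') \<in> mnodes \<nu>" "(k, r', s) \<in> mnodes \<nu>"
    using mnodes_down_closed[OF \<nu>, of k r' s'] b pos lt by auto
  have "X b < X (k, r, s')" "X (k, r, s') < X b'" "X b < X (k, r', s)" "X (k, r', s) < X b'"
    using lt m b by (auto intro!: standard_mono[OF \<nu> X] simp: node_le_def)
  moreover have "X (k, r, s') \<noteq> X (k, r', s)"
    using node_of_eq(2)[OF standard_in_fillings[OF X]] m lt
    by (metis less_irrefl prod.inject)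
  ultimately show False using near by linarith
qed

text \<open>Two distinct tableaux, possibly of different shapes, differ for the first time at two
  nodes that are addable to a common diagram, so they lie on distinct diagonals.\<close>

lemma first_difference:
  assumes \<nu>: "\<nu> \<in> multipartitions n" and X: "X \<in> standard_mtableaux n \<nu>"
    and \<mu>: "\<mu> \<in> multipartitions n" and Y: "Y \<in> standard_mtableaux n \<mu>"
    and "(\<nu>, X) \<noteq> (\<mu>, Y)"
  obtains i where "i \<in> {1..n}"
    "\<And>j. j \<in> {1..<i} \<Longrightarrow> node_of \<nu> X j = node_of \<mu> Y j"
    "fst (node_of \<nu> X i) = fst (node_of \<mu> Y i) \<Longrightarrow> node_diag (node_of \<nu> X i) \<noteq> node_diag (node_of \<mu> Y i)"
proof -
  note XF = standard_in_fillings[OF X] and YF = standard_in_fillings[OF Y]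
  let ?P = "\<lambda>i. i \<in> {1..n} \<and> node_of \<nu> X i \<noteq> node_of \<mu> Y i"
  have "\<exists>i. ?P i"
  proof (rule ccontr)
    assume "\<not> (\<exists>i. ?P i)"
    then have eq: "node_of \<nu> X i = node_of \<mu> Y i" if "i \<in> {1..n}" for i using that by blast
    have "mnodes \<nu> = mnodes \<mu>"
      using node_of_image[OF XF] node_of_image[OF YF] eq by auto
    then have "\<nu> = \<mu>" using mnodes_inject[OF \<nu> \<mu>] by simp
    moreover have "X = Y"
      using fillings_eqI[OF XF] YF eq \<open>\<nu> = \<mu>\<close> by simp
    ultimately show False using assms(5) by simp
  qed
  then have P: "?P (LEAST i. ?P i)" by (rule LeastI_ex)
  define i where "i = (LEAST i. ?P i)"
  have i: "i \<in> {1..n}" "node_of \<nu> X i \<noteq> node_of \<mu> Y i" using P unfolding i_def by auto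
  have before: "node_of \<nu> X j = node_of \<mu> Y j" if "j \<in> {1..<i}" for j
    using not_less_Least[of j ?P] that i(1) unfolding i_def[symmetric] by auto
  \<comment> \<open>If the next node of \<open>W\<close> precedes the next node of \<open>Z\<close>,
    it already belongs to the diagram of \<open>Z\<close> and has an entry below i there.
    \<open>W\<close> agrees with \<open>Z\<close> below i, so it would use this node twice.\<close>
  have impossible: False
    if A: "\<kappa> \<in> multipartitions n" "Z \<in> standard_mtableaux n \<kappa>"
      and B: "W \<in> fillings n \<rho>"
      and bef: "\<And>j. j \<in> {1..<i} \<Longrightarrow> node_of \<kappa> Z j = node_of \<rho> W j"
      and le: "node_le (node_of \<rho> W i) (node_of \<kappa> Z i)" "node_of \<rho> W i \<noteq> node_of \<kappa> Z i"
    for \<kappa> \<rho> :: "'a \<Rightarrow> nat list" and Z W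
  proof -
    note ZF = standard_in_fillings[OF A(2)]
    let ?b = "node_of \<rho> W i"
    obtain k r s r' s' where eq: "?b = (k, r, s)" "node_of \<kappa> Z i = (k, r', s')"
      and rs: "r \<le> r'" "s \<le> s'"
      using le(1) by (cases "?b"; cases "node_of \<kappa> Z i") (simp add: node_le_def)
    have b: "?b \<in> mnodes \<kappa>"
      using mnodes_down_closed[OF A(1), of k r' s' r s] node_of_in(1)[OF ZF i(1)]
        node_of_positive[OF B i(1)] rs by (simp add: eq)
    have "Z ?b < i"
      using standard_mono[OF A b node_of_in(1)[OF ZF i(1)] le] node_of_in(2)[OF ZF i(1)] by simp
    then have "Z ?b \<in> {1..<i}" "node_of \<kappa> Z (Z ?b) = ?b"
      using node_of_eq[OF ZF b] by auto
    then have "node_of \<rho> W (Z ?b) = node_of \<rho> W i" using bef by simp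
    then show False
      using node_of_inject[OF B] \<open>Z ?b \<in> _\<close> i(1) by auto
  qed
  have diag: "node_diag (node_of \<nu> X i) \<noteq> node_diag (node_of \<mu> Y i)"
    if "fst (node_of \<nu> X i) = fst (node_of \<mu> Y i)"
  proof
    assume "node_diag (node_of \<nu> X i) = node_diag (node_of \<mu> Y i)"
    \<comment> \<open>In one component, any two nodes on a common diagonal are comparable.\<close>
    then have "node_le (node_of \<nu> X i) (node_of \<mu> Y i) \<or> node_le (node_of \<mu> Y i) (node_of \<nu> X i)"
      using that by (auto simp: node_diag_def node_le_def split: prod.splits)
    then show False
    proof
      assume "node_le (node_of \<nu> X i) (node_of \<mu> Y i)"
      from impossible[OF \<mu> Y XF before[symmetric] this i(2)] show False .
    next
      assume "node_le (node_of \<mu> Y i) (node_of \<nu> X i)"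
      from impossible[OF \<nu> X YF before this i(2)[symmetric]] show False .
    qed
  qed
  show thesis using that[OF i(1) before diag] .
qed

section \<open>Existence and connectedness of standard tableaux\<close>

lemma standard_exists:
  fixes \<nu> :: "'m::{finite,linorder} \<Rightarrow> nat list"
  assumes "\<nu> \<in> multipartitions n"
  shows "standard_mtableaux n \<nu> \<noteq> {}"
proof -
  \<comment> \<open>The rank in the lexicographic order on component, row and column, a linear order
    that refines \<open>node_le\<close>.\<close>
  define X where "X = (\<lambda>b\<in>mnodes \<nu>. card {c\<in>mnodes \<nu>. c \<le> b})"
  have mono: "X b < X b'" if "b \<in> mnodes \<nu>" "b' \<in> mnodes \<nu>" "b < b'" for b b'
  proof -
    have "b' \<in> {c\<in>mnodes \<nu>. c \<le> b'}" "b' \<notin> {c\<in>mnodes \<nu>. c \<le> b}"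
      using that by (auto simp del: less_prod_simp less_eq_prod_simp)
    moreover have "{c\<in>mnodes \<nu>. c \<le> b} \<subseteq> {c\<in>mnodes \<nu>. c \<le> b'}"
      using that(3) by (metis (no_types, lifting) Collect_mono less_imp_le order_trans)
    ultimately have "card {c\<in>mnodes \<nu>. c \<le> b} < card {c\<in>mnodes \<nu>. c \<le> b'}"
      using finite_mnodes[of \<nu>] by (intro psubset_card_mono) auto
    then show ?thesis using that by (simp add: X_def)
  qed
  have inj: "inj_on X (mnodes \<nu>)"
    by (rule inj_onI) (metis less_irrefl linorder_less_linear mono)
  have range: "X b \<in> {1..n}" if "b \<in> mnodes \<nu>" for b
  proof -
    have "card {c\<in>mnodes \<nu>. c \<le> b} \<le> card (mnodes \<nu>)"
      by (intro card_mono finite_mnodes) auto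
    moreover have "card {c\<in>mnodes \<nu>. c \<le> b} > 0"
    proof -
      have "b \<in> {c\<in>mnodes \<nu>. c \<le> b}" using that by (simp del: less_eq_prod_simp)
      then show ?thesis using finite_mnodes[of \<nu>] card_gt_0_iff by fastforce
    qed
    ultimately show ?thesis using that card_mnodes[OF assms] by (simp add: X_def)
  qed
  have "X ` mnodes \<nu> = {1..n}"
    using range card_image[OF inj] card_mnodes[OF assms] by (intro card_subset_eq) auto
  then have "X \<in> fillings n \<nu>"
    using inj range by (auto simp: fillings_def bij_betw_def X_def)
  moreover have "b < b'" if "node_le b b'" "b \<noteq> b'" for b b' :: "'m mnode"
    using that by (auto simp: node_le_def)
  ultimately have "X \<in> standard_mtableaux n \<nu>"
    using mono by (intro standardI) blast+
  then show ?thesis by blast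
qed

text \<open>Without a descent, sending i to the entry in \<open>Y\<close> of the node carrying i in
  \<open>X\<close> would be a strictly increasing self-map of {1..n}, hence the identity.\<close>

lemma standard_descent:
  assumes \<nu>: "\<nu> \<in> multipartitions n" and X: "X \<in> standard_mtableaux n \<nu>"
    and Y: "Y \<in> standard_mtableaux n \<nu>" and "X \<noteq> Y"
  obtains i where "1 \<le> i" "i < n" "Y (node_of \<nu> X (i + 1)) < Y (node_of \<nu> X i)"
proof -
  note XF = standard_in_fillings[OF X] and YF = standard_in_fillings[OF Y]
  let ?p = "\<lambda>i. Y (node_of \<nu> X i)"
  show thesis
  proof (rule ccontr)
    assume "\<not> thesis"
    with that have le: "?p i \<le> ?p (Suc i)" if "1 \<le> i" "i < n" for i
      using that by (metis Suc_eq_plus1 not_le_imp_less)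
    have neq: "?p i \<noteq> ?p j" if "i \<in> {1..n}" "j \<in> {1..n}" "i \<noteq> j" for i j
      using that node_of_in[OF XF] node_of_eq(2)[OF YF] node_of_inject[OF XF] by metis
    have lt: "?p i < ?p (Suc i)" if "1 \<le> i" "i < n" for i
      using le[OF that] neq[of i "Suc i"] that by simp
    have range: "?p i \<in> {1..n}" if "i \<in> {1..n}" for i
      using that node_of_in[OF XF] node_of_eq(1)[OF YF] by simp
    have lower: "i \<le> ?p i" if "1 \<le> i" "i \<le> n" for i
      using that
    proof (induction i rule: nat_induct_at_least)
      case base
      then show ?case using range[of 1] by simp
    next
      case (Suc i)
      then show ?case using lt[of i] by simp
    qed
    have upper: "?p i \<le> i" if "i \<le> n" "1 \<le> i" for i
      using that
    proof (induction i rule: inc_induct)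
      case base
      then show ?case using range[of n] by simp
    next
      case (step i)
      then show ?case using lt[of i] by simp
    qed
    have "X = Y"
    proof (rule fillings_eqI[OF XF YF])
      fix i assume i: "i \<in> {1..n}"
      then have "?p i = i" using lower[of i] upper[of i] by simp
      then show "node_of \<nu> X i = node_of \<nu> Y i"
        using node_of_eq(2)[OF YF node_of_in(1)[OF XF i]] by simp
    qed
    with assms(4) show False by simp
  qed
qed

text \<open>Bubble sort: the pairs of nodes that \<open>X\<close> and \<open>Y\<close> order
  differently are counted by \<open>invs\<close>, and exchanging the entries at a descent removes
  such a pair without creating one.\<close>

lemma standard_connected:
  fixes \<nu> :: "'m::finite \<Rightarrow> nat list"
  assumes \<nu>: "\<nu> \<in> multipartitions n" and X: "X \<in> standard_mtableaux n \<nu>"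
    and Y: "Y \<in> standard_mtableaux n \<nu>" and "P X"
    and step: "\<And>Z i. Z \<in> standard_mtableaux n \<nu> \<Longrightarrow> P Z \<Longrightarrow> 1 \<le> i \<Longrightarrow> i < n \<Longrightarrow>
      swap_entries \<nu> i Z \<in> standard_mtableaux n \<nu> \<Longrightarrow> P (swap_entries \<nu> i Z)"
  shows "P Y"
proof -
  define invs where "invs X = {(b, b') \<in> mnodes \<nu> \<times> mnodes \<nu>. X b < X b' \<and> Y b' < Y b}" for X :: "'m mtableau"
  have fin: "finite (invs X)" for X
    unfolding invs_def by (rule finite_subset[of _ "mnodes \<nu> \<times> mnodes \<nu>"]) (auto simp: finite_mnodes)
  show ?thesis
    using X \<open>P X\<close>
  proof (induction "card (invs X)" arbitrary: X rule: less_induct)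
    case less
    note XF = standard_in_fillings[OF less.prems(1)]
    show ?case
    proof (cases "X = Y")
      case True
      then show ?thesis using less.prems by simp
    next
      case False
      from standard_descent[OF \<nu> less.prems(1) Y False]
      obtain i where i: "1 \<le> i" "i < n" "Y (node_of \<nu> X (i + 1)) < Y (node_of \<nu> X i)" .
      let ?x = "node_of \<nu> X i" and ?y = "node_of \<nu> X (i + 1)" and ?Z = "swap_entries \<nu> i X"
      have xy: "?x \<in> mnodes \<nu>" "X ?x = i" "?y \<in> mnodes \<nu>" "X ?y = i + 1"
        using node_of_in[OF XF] i by auto
      \<comment> \<open>\<open>Y\<close> decreases from \<open>?x\<close> to \<open>?y\<close>, so
        these nodes are not in the order that would make the swap leave the standard
        tableaux.\<close>
      have "\<not> node_le ?x ?y"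
        using standard_mono[OF \<nu> Y xy(1,3)] i xy by (metis less_asym less_irrefl)
      then have Z: "?Z \<in> standard_mtableaux n \<nu>"
        using swap_entries_standard_iff[OF \<nu> less.prems(1) i(1,2)] by simp
      have "invs ?Z \<subset> invs X"
      proof
        show "invs ?Z \<subseteq> invs X"
        proof safe
          fix b b' assume "(b, b') \<in> invs ?Z"
          then have b: "b \<in> mnodes \<nu>" "b' \<in> mnodes \<nu>" "?Z b < ?Z b'" "Y b' < Y b"
            by (auto simp: invs_def)
          have "\<not> (X b' = i \<and> X b = i + 1)"
            using b i node_of_eq(2)[OF XF b(1)] node_of_eq(2)[OF XF b(2)] by auto
          then have "X b < X b'"
            using b by (auto simp: swap_entries_def transpose_def split: if_splits)
          with b show "(b, b') \<in> invs X" by (simp add: invs_def)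
        qed
        have "(?x, ?y) \<in> invs X" "(?x, ?y) \<notin> invs ?Z"
          using xy i by (auto simp: invs_def swap_entries_def)
        then show "invs ?Z \<noteq> invs X" by blast
      qed
      then have "card (invs ?Z) < card (invs X)" by (intro psubset_card_mono fin)
      from less.hyps[OF this Z step[OF less.prems(1,2) i(1,2) Z]] show ?thesis .
    qed
  qed
qed

section \<open>The defining relations\<close>

text \<open>Here \<open>a\<close> and \<open>k - a\<close> are the diagonal coefficients at a
  filling and at its swap, \<open>t\<close> and \<open>u\<close> the off-diagonal ones,
  \<open>F\<close> and \<open>G\<close> the two coordinates. In \<open>tau_braid_identity\<close>,
  \<open>c\<close> and \<open>d\<close> are the two contents.\<close>

lemma quadratic_identity:
  fixes a t u k F G :: "'a::comm_ring_1"
  assumes "t * u = 1 + k * a - a * a"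
  shows "a * (a * F + t * G) + t * ((k - a) * G + u * F) = k * (a * F + t * G) + F"
    (is "?L = ?R")
proof -
  have "?L - ?R = (t * u - (1 + k * a - a * a)) * F" by (simp add: algebra_simps)
  with assms show ?thesis by simp
qed

lemma tau_braid_identity:
  fixes a b t u c d F G :: "'a::comm_ring_1"
  assumes "c * a + d * b = 0"
  shows "c * (a * (c * (a * F + t * G)) + t * (d * (b * G + u * F)))
    = a * (c * (a * (c * F) + t * (d * G))) + t * (d * (b * (d * G) + u * (c * F)))" (is "?L = ?R")
proof -
  have "?L - ?R = t * G * (c - d) * (c * a + d * b)" by (simp add: algebra_simps)
  with assms show ?thesis by simp
qed

text \<open>The six unknowns are the coordinates at the six arrangements of three consecutive
  entries. Those of \<open>F12\<close>, \<open>F21\<close> and \<open>W\<close> cancel outright,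
  those of \<open>F1\<close> and \<open>F2\<close> up to the Yang-Baxter defect \<open>e\<close>;
  only the coefficient of \<open>F\<close> also needs the two product formulas.\<close>

lemma braid_identity:
  fixes axy ayz axz txy tyx tyz tzy tzx k F F1 F2 F12 F21 W :: "'a::comm_ring_1"
  assumes "tyx * txy = 1 + k * axy - axy * axy" "tzy * tyz = 1 + k * ayz - ayz * ayz"
    and "axy * ayz = axz * (axy + ayz - k)"
  shows "axy * (ayz * (axy * F + tyx * F1) + tzy * (axz * F2 + tzx * F12)) +
      tyx * (axz * ((k - axy) * F1 + txy * F) + tzx * (ayz * F21 + tzy * W))
    = ayz * (axy * (ayz * F + tzy * F2) + tyx * (axz * F1 + tzx * F21)) +
      tzy * (axz * ((k - ayz) * F2 + tyz * F) + tzx * (axy * F12 + tyx * W))" (is "?L = ?R")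
proof -
  define e where "e = axy * ayz - axz * (axy + ayz - k)"
  have "?L - ?R = F * (e * (axy - ayz) + axz * ((tyx * txy - (1 + k * axy - axy * axy)) -
      (tzy * tyz - (1 + k * ayz - ayz * ayz)))) + F1 * tyx * e - F2 * tzy * e"
    unfolding e_def by (simp add: algebra_simps)
  with assms show ?thesis by (simp add: e_def)
qed

text \<open>Over an arbitrary field, so that the generic and the complex parameters are two
  instances of one argument.\<close>

locale admissible =
  fixes q :: "'k::field" and v :: "'m::{finite,linorder} \<Rightarrow> 'k" and n :: nat
  assumes n_pos: "1 \<le> n" and q_nonzero: "q \<noteq> 0"
    and quantum_nonzero: "\<And>N. N < n \<Longrightarrow> (\<Sum>i\<le>N. q ^ (2 * i)) \<noteq> 0"
    and cross: "\<And>i j k. j \<noteq> k \<Longrightarrow> - int n < i \<Longrightarrow> i < int n \<Longrightarrow> q powi (2 * i) * v j - v k \<noteq> 0"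
    and v_nonzero: "\<And>j. v j \<noteq> 0"
begin

abbreviation kappa :: 'k ("\<kappa>") where "\<kappa> \<equiv> q - inverse q"
abbreviation content :: "'m mnode \<Rightarrow> 'k" where "content \<equiv> node_content q v"
abbreviation diag_coeff :: "'m mnode \<Rightarrow> 'm mnode \<Rightarrow> 'k" where "diag_coeff \<equiv> sigma_diag_coeff q v"

text \<open>Unlike the coefficient in the definition of the action, this one vanishes on adjacent nodes. The
  formula for \<open>\<sigma>\<^sub>i\<close> below then holds at all fillings, so that the relations can be checked without
  distinguishing which of the tableaux involved are standard.\<close>

definition swap_coeff :: "'m mnode \<Rightarrow> 'm mnode \<Rightarrow> 'k" where
  "swap_coeff x y = (if node_adj x y \<or> node_adj y x then 0 else diag_coeff x y + inverse q)"

text \<open>The pairs of nodes whose coefficient has a nonzero denominator, either in the usual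
  formula or in the limiting one.\<close>

definition regular :: "'m mnode \<Rightarrow> 'm mnode \<Rightarrow> bool" where
  "regular x y \<longleftrightarrow> content x \<noteq> content y \<or>
     q\<^sup>2 = 1 \<and> fst x = fst y \<and> (of_int (node_diag y - node_diag x) :: 'k) \<noteq> 0"

text \<open>Multiplying the geometric sum by q^2 - 1 raises the exponent by one step, which turns
  the assumption for N < n into a statement up to \<open>n\<close>.\<close>

lemma power_neq_1:
  assumes "q\<^sup>2 \<noteq> 1" "0 < N" "N \<le> n"
  shows "q ^ (2 * N) \<noteq> 1"
proof -
  obtain M where M: "N = Suc M" "M < n" using assms by (cases N) auto
  have "(q\<^sup>2 - 1) * (\<Sum>i\<le>M. q ^ (2 * i)) = q ^ (2 * N) - 1"
    using power_diff_1_eq[of "q\<^sup>2" N] M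
    by (simp only: power_mult lessThan_Suc_atMost)
  moreover have "(q\<^sup>2 - 1) * (\<Sum>i\<le>M. q ^ (2 * i)) \<noteq> 0"
    using assms quantum_nonzero[OF M(2)] by simp
  ultimately show ?thesis by auto
qed

lemma powi_neq_1:
  assumes "q\<^sup>2 \<noteq> 1" "d \<noteq> 0" "\<bar>d\<bar> \<le> int n"
  shows "q powi (2 * d) \<noteq> 1"
proof -
  have "q ^ (2 * nat \<bar>d\<bar>) \<noteq> 1"
    using assms by (intro power_neq_1) auto
  moreover have "nat (2 * d) = 2 * nat d" "nat (- (2 * d)) = 2 * nat (- d)" by auto
  ultimately show ?thesis
    using assms(2) by (auto simp: power_int_def abs_if power_inverse split: if_splits)
qed

text \<open>At q^2 = 1 the sum 1 + q^2 + ... + q^(2N) is N + 1; this replaces an assumption on the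
  characteristic.\<close>

lemma of_int_neq_0:
  assumes "q\<^sup>2 = 1" "d \<noteq> 0" "\<bar>d\<bar> \<le> int n"
  shows "(of_int d :: 'k) \<noteq> 0"
proof -
  obtain M where M: "nat \<bar>d\<bar> = Suc M" "M < n" using assms by (cases "nat \<bar>d\<bar>") auto
  have "of_nat (nat \<bar>d\<bar>) \<noteq> (0::'k)"
    using quantum_nonzero[OF M(2)] assms(1) M by (simp add: power_mult)
  then show ?thesis
    by (cases "d \<ge> 0") (auto simp: of_nat_nat)
qed

lemma content_square_1: "q\<^sup>2 = 1 \<Longrightarrow> content x = v (fst x)"
  by (simp add: node_content_def power_int_mult)

lemma content_nonzero: "content x \<noteq> 0"
  using q_nonzero v_nonzero by (simp add: node_content_def)

lemma content_neq_distinct_components: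
  assumes "fst x \<noteq> fst y" "\<bar>node_diag x - node_diag y\<bar> < int n"
  shows "content x \<noteq> content y"
proof
  assume "content x = content y"
  then have "q powi (2 * (node_diag x - node_diag y)) * v (fst x) = v (fst y)"
    using q_nonzero by (simp add: node_content_def right_diff_distrib power_int_diff field_simps)
  then show False
    using cross[OF assms(1), of "node_diag x - node_diag y"] assms(2) by (simp add: abs_less_iff)
qed

text \<open>Both bounds are as wide as the parameter conditions allow:
  \<open>quantum_nonzero\<close> reaches differences up to \<open>n\<close> in one component,
  \<open>cross\<close> only those below \<open>n\<close>.\<close>

lemma regularI:
  assumes "fst x = fst y \<Longrightarrow> node_diag x \<noteq> node_diag y \<and> \<bar>node_diag x - node_diag y\<bar> \<le> int n"
    and "fst x \<noteq> fst y \<Longrightarrow> \<bar>node_diag x - node_diag y\<bar> < int n"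
  shows "regular x y"
proof (cases "fst x = fst y")
  case False
  then show ?thesis
    using assms(2) content_neq_distinct_components by (simp add: regular_def)
next
  case True
  with assms(1) have d: "node_diag y - node_diag x \<noteq> 0" "\<bar>node_diag y - node_diag x\<bar> \<le> int n" by auto
  show ?thesis
  proof (cases "q\<^sup>2 = 1")
    case True
    then show ?thesis
      using of_int_neq_0[OF True d] \<open>fst x = fst y\<close> by (simp add: regular_def)
  next
    case False
    have "content y = content x * q powi (2 * (node_diag y - node_diag x))"
      using True q_nonzero by (simp add: node_content_def right_diff_distrib power_int_diff)
    then have "content y \<noteq> content x"
      using powi_neq_1[OF False d] content_nonzero[of x] by simp
    then show ?thesis by (simp add: regular_def)
  qed
qed

lemma regular_sym: "regular x y \<Longrightarrow> regular y x"
  by (auto simp: regular_def)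

lemma regular_content_eqD:
  assumes "regular x y" "content x = content y"
  shows "q\<^sup>2 = 1" "inverse q = q" "fst x = fst y" "(of_int (node_diag x) :: 'k) \<noteq> of_int (node_diag y)"
  using assms q_nonzero by (auto simp: regular_def field_simps power2_eq_square)

section \<open>Identities of the diagonal coefficients\<close>

lemma diag_coeff_content:
  assumes "regular x y"
  shows "diag_coeff x y * (content y - content x) = \<kappa> * content y"
  using regular_content_eqD[OF assms]
  by (cases "content x = content y") (auto simp: sigma_diag_coeff_def Let_def)

lemma diag_coeff_eq:
  assumes "content x = content y"
  shows "diag_coeff x y = q / (of_int (node_diag y) - of_int (node_diag x))"
  using assms by (simp add: sigma_diag_coeff_def)

text \<open>The trace of the 2 by 2 matrix of \<sigma> on a filling and its swap, whose eigenvalues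
  are to be q and -1/q.\<close>

lemma diag_coeff_skew:
  assumes "regular x y"
  shows "diag_coeff y x = \<kappa> - diag_coeff x y"
proof (cases "content x = content y")
  case True
  note D = regular_content_eqD[OF assms True]
  have "q / (b - a) = - (q / (a - b))" for a b :: 'k
    using minus_divide_right[of q "a - b"] by simp
  then have "diag_coeff y x = - diag_coeff x y"
    unfolding diag_coeff_eq[OF True] diag_coeff_eq[OF True[symmetric]] .
  then show ?thesis using D(2) by simp
next
  case False
  have "\<kappa> * a / (a - b) + \<kappa> * b / (b - a) = \<kappa>" if "a \<noteq> b" for a b
  proof -
    have "\<kappa> * b / (b - a) = - (\<kappa> * b / (a - b))"
      using minus_divide_right[of "\<kappa> * b" "a - b"] by simp
    then have "\<kappa> * a / (a - b) + \<kappa> * b / (b - a) = \<kappa> * (a - b) / (a - b)"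
      by (simp add: right_diff_distrib diff_divide_distrib)
    then show ?thesis using that by simp
  qed
  from this[of "content x" "content y"] this[of "content y" "content x"] False show ?thesis
    by (simp add: sigma_diag_coeff_def Let_def algebra_simps)
qed

lemma sigma_swap_coeff_eq:
  assumes "regular x y"
  shows "sigma_swap_coeff q v x y = diag_coeff x y + inverse q"
proof (cases "content x = content y")
  case True
  then show ?thesis
    using regular_content_eqD[OF assms True]
    by (simp add: sigma_swap_coeff_def sigma_diag_coeff_def field_simps)
next
  case False
  have "(q * b - inverse q * a) / (b - a) = \<kappa> * b / (b - a) + inverse q" if "a \<noteq> b" for a b
  proof -
    have "\<kappa> * b / (b - a) + inverse q = (\<kappa> * b + inverse q * (b - a)) / (b - a)"
      using that by (simp add: add_divide_distrib)
    then show ?thesis by (simp add: algebra_simps)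
  qed
  from this[OF False] False show ?thesis
    by (simp add: sigma_swap_coeff_def sigma_diag_coeff_def Let_def)
qed

lemma diag_coeff_yang_baxter:
  assumes "regular x y" "regular y z" "regular x z"
  shows "diag_coeff x y * diag_coeff y z = diag_coeff x z * (diag_coeff x y + diag_coeff y z - \<kappa>)"
proof (cases "q\<^sup>2 = 1")
  case False
  then have ne: "content x \<noteq> content y" "content y \<noteq> content z" "content x \<noteq> content z"
    using assms by (auto simp: regular_def)
  let ?x = "content x" and ?y = "content y" and ?z = "content z"
  have a: "diag_coeff x y = \<kappa> * ?y / (?y - ?x)" "diag_coeff y z = \<kappa> * ?z / (?z - ?y)"
    "diag_coeff x z = \<kappa> * ?z / (?z - ?x)"
    using ne by (simp_all add: sigma_diag_coeff_def Let_def)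
  have "diag_coeff x y + diag_coeff y z - \<kappa> = \<kappa> * (?y * (?z - ?x)) / ((?y - ?x) * (?z - ?y))"
    unfolding a using ne by (simp add: divide_simps) (simp add: algebra_simps)
  then show ?thesis
    unfolding a using ne by (simp add: divide_simps)
next
  case True
  then have inv: "inverse q = q" using q_nonzero by (simp add: field_simps power2_eq_square)
  \<comment> \<open>The numerator contains q - 1/q = 0. If the three contents are not all equal, at
    least two of the three pairs have distinct contents, and both sides vanish.\<close>
  have zero: "diag_coeff x y = 0" if "content x \<noteq> content y" for x y
    using that by (simp add: sigma_diag_coeff_def inv Let_def)
  show ?thesis
  proof (cases "content x = content y \<and> content y = content z")
    case True
    then have eq: "content x = content y" "content y = content z" "content x = content z" by auto
    note d = regular_content_eqD(4)[OF assms(1) eq(1)] regular_content_eqD(4)[OF assms(2) eq(2)]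
      regular_content_eqD(4)[OF assms(3) eq(3)]
    show ?thesis
      unfolding diag_coeff_eq[OF eq(1)] diag_coeff_eq[OF eq(2)] diag_coeff_eq[OF eq(3)] inv
      using d by (simp add: divide_simps) (simp add: algebra_simps)
  next
    case False
    then show ?thesis
      using zero by (cases "content x = content y"; cases "content y = content z";
          cases "content x = content z") (auto simp: inv)
  qed
qed

text \<open>The coefficient is the eigenvalue q for a right neighbour and -1/q for a lower one. This
  makes the value 0 of \<open>swap_coeff\<close> on adjacent nodes compatible with the product
  formula below.\<close>

lemma diag_coeff_adj:
  assumes "regular x y" "node_adj x y \<or> node_adj y x"
  shows "(diag_coeff x y + inverse q) * (q - diag_coeff x y) = 0"
proof -
  have directed: "diag_coeff x y = q \<or> diag_coeff x y = - inverse q"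
    if adj: "node_adj x y" and reg: "regular x y" for x y
  proof -
    have fst: "fst x = fst y" and d: "node_diag y - node_diag x \<in> {1, - 1}"
      using adj by (auto simp: node_adj_def node_diag_def)
    show ?thesis
    proof (cases "content x = content y")
      case True
      note D = regular_content_eqD[OF reg True]
      have "diag_coeff x y = q / of_int (node_diag y - node_diag x)"
        using True by (simp add: sigma_diag_coeff_def)
      then show ?thesis using d D(2) by (auto simp del: of_int_diff)
    next
      case False
      have c: "content y = content x * q powi (2 * (node_diag y - node_diag x))"
        using fst q_nonzero by (simp add: node_content_def right_diff_distrib power_int_diff)
      have a: "diag_coeff x y * (content y - content x) = \<kappa> * content y"
        by (rule diag_coeff_content[OF reg])
      from d consider "node_diag y - node_diag x = 1" | "node_diag y - node_diag x = - 1" by blast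
      then show ?thesis
      proof cases
        case 1
        then have cy: "content y = content x * q\<^sup>2" using c by simp
        with False have ne: "q\<^sup>2 - 1 \<noteq> 0" by auto
        have "q * (content y - content x) = \<kappa> * content y"
          using q_nonzero unfolding cy by (simp add: field_simps power2_eq_square)
        with a False show ?thesis by (metis mult_cancel_right right_minus_eq)
      next
        case 2
        then have cy: "content y = content x * inverse (q\<^sup>2)" using c by (simp add: power_int_def power_inverse)
        have "- inverse q * (content y - content x) = \<kappa> * content y"
          using q_nonzero unfolding cy by (simp add: field_simps power2_eq_square)
        with a False show ?thesis by (metis mult_cancel_right right_minus_eq)
      qed
    qed
  qed
  have "diag_coeff x y = q \<or> diag_coeff x y = - inverse q"
    using assms(2)
  proof
    assume "node_adj y x"
    then show ?thesis
      using directed[of y x] regular_sym[OF assms(1)]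
        diag_coeff_skew[OF regular_sym[OF assms(1)]] by auto
  qed (use assms(1) directed in blast)
  then show ?thesis by auto
qed

lemma swap_coeff_mult:
  assumes "regular x y"
  shows "swap_coeff x y * swap_coeff y x = (diag_coeff x y + inverse q) * (q - diag_coeff x y)"
  using diag_coeff_adj[OF assms] by (auto simp: swap_coeff_def diag_coeff_skew[OF assms])

text \<open>In view of \<open>diag_coeff_skew\<close> this says that the 2 by 2 matrix of \<sigma>
  has determinant -1.\<close>

lemma swap_coeff_mult_expand:
  assumes "regular x y"
  shows "swap_coeff x y * swap_coeff y x = 1 + \<kappa> * diag_coeff x y - diag_coeff x y * diag_coeff x y"
  using q_nonzero by (simp add: swap_coeff_mult[OF assms] algebra_simps)

subsection \<open>The action on coordinates\<close>

lemma near_entries_regular: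
  assumes \<nu>: "\<nu> \<in> multipartitions n" and X: "X \<in> standard_mtableaux n \<nu>"
    and ij: "i \<in> {1..n}" "j \<in> {1..n}" "i < j" "j \<le> i + 2"
  shows "regular (node_of \<nu> X i) (node_of \<nu> X j)"
proof -
  note XF = standard_in_fillings[OF X]
  \<comment> \<open>The nodes with entries below j contain both hooks and number at most n -
    1.\<close>
  let ?S = "node_of \<nu> X ` {1..<j}"
  have "hook (node_of \<nu> X i) \<subseteq> node_of \<nu> X ` {1..<i}" by (rule hook_standard[OF \<nu> X ij(1)])
  also have "\<dots> \<subseteq> ?S" using ij by auto
  finally have hooks: "hook (node_of \<nu> X i) \<subseteq> ?S" "hook (node_of \<nu> X j) \<subseteq> ?S"
    using hook_standard[OF \<nu> X ij(2)] by auto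
  have "card ?S \<le> card {1..<j}" by (rule card_image_le) simp
  then have card: "int (card ?S) \<le> int n - 1" using ij by auto
  note pos = node_of_positive[OF XF ij(1)] node_of_positive[OF XF ij(2)]
  show ?thesis
  proof (rule regularI)
    assume same: "fst (node_of \<nu> X i) = fst (node_of \<nu> X j)"
    have "node_diag (node_of \<nu> X i) \<noteq> node_diag (node_of \<nu> X j)"
      using same ij node_of_in[OF XF ij(1)] node_of_in[OF XF ij(2)]
      by (intro near_entries_distinct_diag[OF \<nu> X]) auto
    with hook_diag_same_component[OF _ hooks same pos] card
    show "node_diag (node_of \<nu> X i) \<noteq> node_diag (node_of \<nu> X j) \<and>
        \<bar>node_diag (node_of \<nu> X i) - node_diag (node_of \<nu> X j)\<bar> \<le> int n" by simp
  next
    assume "fst (node_of \<nu> X i) \<noteq> fst (node_of \<nu> X j)"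
    from hook_diag_distinct_components[OF _ hooks this pos] card
    show "\<bar>node_diag (node_of \<nu> X i) - node_diag (node_of \<nu> X j)\<bar> < int n" by simp
  qed
qed

lemma tau_formula:
  assumes "f \<in> carrier (V_module q v n \<nu>)"
  shows "gen_action q v n \<nu> Tau f Y = content (node_of \<nu> Y 1) * f Y"
proof (cases "Y \<in> standard_mtableaux n \<nu>")
  case True
  have "gen_action q v n \<nu> Tau f Y =
      (\<Sum>X\<in>standard_mtableaux n \<nu>. if X = Y then f Y * content (node_of \<nu> Y 1) else 0)"
    unfolding gen_action_def by (intro sum.cong refl) (auto simp: basis_vec_def)
  then show ?thesis
    using True by (simp add: finite_standard_mtableaux mult.commute)
next
  case False
  then show ?thesis
    using gen_action_supported assms by (simp add: V_module_carrier)
qed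

text \<open>The coordinate at \<open>Y\<close> receives contributions from the basis vectors of
  \<open>Y\<close> and of its swap. The latter carries the two nodes in the opposite order, hence
  the reversed arguments of \<open>swap_coeff\<close>.\<close>

lemma sigma_formula:
  assumes \<nu>: "\<nu> \<in> multipartitions n" and f: "f \<in> carrier (V_module q v n \<nu>)"
    and Y: "Y \<in> fillings n \<nu>" and i: "1 \<le> i" "i < n"
  shows "gen_action q v n \<nu> (Sigma i) f Y =
    diag_coeff (node_of \<nu> Y i) (node_of \<nu> Y (i + 1)) * f Y +
    swap_coeff (node_of \<nu> Y (i + 1)) (node_of \<nu> Y i) * f (swap_entries \<nu> i Y)"
proof -
  let ?T = "standard_mtableaux n \<nu>" and ?Z = "swap_entries \<nu> i Y"
  let ?x = "node_of \<nu> Y i" and ?y = "node_of \<nu> Y (i + 1)"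
  have ZF: "?Z \<in> fillings n \<nu>" by (rule swap_entries_fillings[OF Y i])
  have Zn: "node_of \<nu> ?Z i = ?y" "node_of \<nu> ?Z (i + 1) = ?x"
    using node_of_swap_entries_simps(1,2)[OF Y i] by auto
  have adj: "node_adj (node_of \<nu> X i) (node_of \<nu> X (i + 1))"
    if "X \<in> ?T" "swap_entries \<nu> i X \<notin> ?T" for X
    using consecutive_le_imp_adj[OF \<nu> that(1)] swap_entries_standard_iff[OF \<nu> that(1) i] that(2)
      node_of_in[OF standard_in_fillings[OF that(1)], of i]
      node_of_in[OF standard_in_fillings[OF that(1)], of "i + 1"] i by auto
  have not_adj: "\<not> node_adj (node_of \<nu> X i) (node_of \<nu> X (i + 1))"
    if "X \<in> ?T" "swap_entries \<nu> i X \<in> ?T" for X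
    using swap_entries_standard_iff[OF \<nu> that(1) i] that(2)
    by (auto simp: node_adj_def node_le_def)
  show ?thesis
  proof (cases "Y \<in> ?T")
    case True
    have "gen_action q v n \<nu> (Sigma i) f Y =
        (\<Sum>X\<in>?T. (if X = Y then diag_coeff ?x ?y * f Y else 0) +
          (if X = ?Z then sigma_swap_coeff q v ?y ?x * f ?Z else 0))"
      unfolding gen_action_def
    proof (intro sum.cong refl)
      fix X assume X: "X \<in> ?T"
      have "swap_entries \<nu> i X = Y \<longleftrightarrow> X = ?Z"
        using swap_entries_swap_entries[OF standard_in_fillings[OF X]] swap_entries_swap_entries[OF Y]
        by metis
      then show "f X * gen_on_basis q v n \<nu> (Sigma i) X Y =
          (if X = Y then diag_coeff ?x ?y * f Y else 0) +
          (if X = ?Z then sigma_swap_coeff q v ?y ?x * f ?Z else 0)"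
        using True Zn by (auto simp: basis_vec_def algebra_simps)
    qed
    also have "\<dots> = diag_coeff ?x ?y * f Y + (if ?Z \<in> ?T then sigma_swap_coeff q v ?y ?x * f ?Z else 0)"
      using True by (simp add: sum.distrib finite_standard_mtableaux)
    also have "(if ?Z \<in> ?T then sigma_swap_coeff q v ?y ?x * f ?Z else 0) = swap_coeff ?y ?x * f ?Z"
    proof (cases "?Z \<in> ?T")
      case Z: True
      have "regular ?x ?y" using near_entries_regular[OF \<nu> True, of i "i + 1"] i by simp
      moreover have "\<not> node_adj ?x ?y" "\<not> node_adj ?y ?x"
        using not_adj[OF True Z] not_adj[OF Z] True Zn swap_entries_swap_entries[OF Y] by auto
      ultimately show ?thesis
        using Z by (simp add: swap_coeff_def sigma_swap_coeff_eq regular_sym)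
    next
      case False
      then show ?thesis using f by (simp add: V_module_carrier)
    qed
    finally show ?thesis .
  next
    case False
    \<comment> \<open>If the swap is standard although \<open>Y\<close> is not, the two entries sit
      on adjacent nodes and the coefficient is 0; otherwise \<open>f\<close> vanishes at the
      swap.\<close>
    have "swap_coeff ?y ?x * f ?Z = 0"
    proof (cases "?Z \<in> ?T")
      case True
      from adj[OF True] False have "node_adj ?y ?x"
        using Zn swap_entries_swap_entries[OF Y] by simp
      then show ?thesis by (simp add: swap_coeff_def)
    next
      case Z: False
      then show ?thesis using f by (simp add: V_module_carrier)
    qed
    moreover have "gen_action q v n \<nu> (Sigma i) f Y = 0" "f Y = 0"
      using False f by (simp_all add: V_module_carrier gen_action_supported)
    ultimately show ?thesis by simp
  qed
qed

lemma gen_action_closed: "gen_action q v n \<nu> g f \<in> carrier (V_module q v n \<nu>)"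
  by (simp add: V_module_carrier gen_action_supported)

section \<open>Verification of the relators\<close>

lemma quadratic_relation:
  assumes \<nu>: "\<nu> \<in> multipartitions n" and f: "f \<in> carrier (V_module q v n \<nu>)"
    and Y: "Y \<in> standard_mtableaux n \<nu>" and i: "1 \<le> i" "i < n"
  shows "gen_action q v n \<nu> (Sigma i) (gen_action q v n \<nu> (Sigma i) f) Y
    = \<kappa> * gen_action q v n \<nu> (Sigma i) f Y + f Y"
proof -
  note YF = standard_in_fillings[OF Y]
  note ZF = swap_entries_fillings[OF YF i]
  let ?x = "node_of \<nu> Y i" and ?y = "node_of \<nu> Y (i + 1)"
  have reg: "regular ?x ?y" using near_entries_regular[OF \<nu> Y, of i "i + 1"] i by simp
  note F = sigma_formula[OF \<nu> _ YF i] sigma_formula[OF \<nu> _ ZF i]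
    node_of_swap_entries_simps(1,2)[OF YF i] swap_entries_swap_entries[OF YF]
  have "swap_coeff ?y ?x * swap_coeff ?x ?y = 1 + \<kappa> * diag_coeff ?x ?y - diag_coeff ?x ?y * diag_coeff ?x ?y"
    using swap_coeff_mult_expand[OF reg] by (simp add: mult.commute)
  then show ?thesis
    unfolding F(1)[OF gen_action_closed] F(1,2)[OF f] F(3-) diag_coeff_skew[OF reg]
    by (rule quadratic_identity)
qed

lemma far_relation:
  assumes \<nu>: "\<nu> \<in> multipartitions n" and f: "f \<in> carrier (V_module q v n \<nu>)"
    and Y: "Y \<in> standard_mtableaux n \<nu>" and i: "1 \<le> i" "i < n" and j: "1 \<le> j" "j < n"
    and far: "\<bar>int i - int j\<bar> > 1"
  shows "gen_action q v n \<nu> (Sigma i) (gen_action q v n \<nu> (Sigma j) f) Y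
    = gen_action q v n \<nu> (Sigma j) (gen_action q v n \<nu> (Sigma i) f) Y"
proof -
  note YF = standard_in_fillings[OF Y]
  note F = sigma_formula[OF \<nu> _ YF i] sigma_formula[OF \<nu> _ YF j]
    sigma_formula[OF \<nu> _ swap_entries_fillings[OF YF i] j]
    sigma_formula[OF \<nu> _ swap_entries_fillings[OF YF j] i]
  have "node_of \<nu> (swap_entries \<nu> i Y) j = node_of \<nu> Y j"
    "node_of \<nu> (swap_entries \<nu> i Y) (j + 1) = node_of \<nu> Y (j + 1)"
    "node_of \<nu> (swap_entries \<nu> j Y) i = node_of \<nu> Y i"
    "node_of \<nu> (swap_entries \<nu> j Y) (i + 1) = node_of \<nu> Y (i + 1)"
    using far i j by (auto intro!: node_of_swap_entries_simps(3)[OF YF])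
  then show ?thesis
    unfolding F(1,2)[OF gen_action_closed] F[OF f] swap_entries_commute[OF far]
    by (simp add: algebra_simps)
qed

lemma tau_sigma_relation:
  assumes \<nu>: "\<nu> \<in> multipartitions n" and f: "f \<in> carrier (V_module q v n \<nu>)"
    and Y: "Y \<in> standard_mtableaux n \<nu>" and i: "1 < i" "i < n"
  shows "gen_action q v n \<nu> Tau (gen_action q v n \<nu> (Sigma i) f) Y
    = gen_action q v n \<nu> (Sigma i) (gen_action q v n \<nu> Tau f) Y"
proof -
  note YF = standard_in_fillings[OF Y]
  have i': "1 \<le> i" using i by simp
  have "node_of \<nu> (swap_entries \<nu> i Y) 1 = node_of \<nu> Y 1"
    using i by (intro node_of_swap_entries_simps(3)[OF YF]) auto
  then show ?thesis
    unfolding tau_formula[OF gen_action_closed] tau_formula[OF f]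
      sigma_formula[OF \<nu> gen_action_closed YF i' i(2)] sigma_formula[OF \<nu> f YF i' i(2)]
    by (simp add: algebra_simps)
qed

lemma content_skew:
  assumes "regular x y"
  shows "content x * diag_coeff x y + content y * diag_coeff y x = 0"
  using diag_coeff_content[OF assms] unfolding diag_coeff_skew[OF assms] by (simp add: algebra_simps)

lemma tau_braid_relation:
  assumes \<nu>: "\<nu> \<in> multipartitions n" and f: "f \<in> carrier (V_module q v n \<nu>)"
    and Y: "Y \<in> standard_mtableaux n \<nu>" and n: "1 < n"
  defines "t \<equiv> gen_action q v n \<nu> Tau" and "s \<equiv> gen_action q v n \<nu> (Sigma 1)"
  shows "t (s (t (s f))) Y = s (t (s (t f))) Y"
proof -
  note YF = standard_in_fillings[OF Y]
  have i: "1 \<le> (1::nat)" by simp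
  note ZF = swap_entries_fillings[OF YF i n]
  let ?x = "node_of \<nu> Y 1" and ?y = "node_of \<nu> Y (1 + 1)"
  have reg: "regular ?x ?y" using near_entries_regular[OF \<nu> Y, of 1 "1 + 1"] n by simp
  note F = sigma_formula[OF \<nu> _ YF i n] sigma_formula[OF \<nu> _ ZF i n] tau_formula
  show ?thesis
    unfolding t_def s_def F[OF gen_action_closed] F[OF f] node_of_swap_entries_simps(1,2)[OF YF i n]
      swap_entries_swap_entries[OF YF]
    using content_skew[OF reg] by (rule tau_braid_identity)
qed

lemma braid_relation:
  assumes \<nu>: "\<nu> \<in> multipartitions n" and f: "f \<in> carrier (V_module q v n \<nu>)"
    and Y: "Y \<in> standard_mtableaux n \<nu>" and i: "1 \<le> i" "i + 1 < n"
  defines "s1 \<equiv> gen_action q v n \<nu> (Sigma i)" and "s2 \<equiv> gen_action q v n \<nu> (Sigma (i + 1))"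
  shows "s1 (s2 (s1 f)) Y = s2 (s1 (s2 f)) Y"
proof -
  note YF = standard_in_fillings[OF Y]
  have j: "1 \<le> i" "i < n" "1 \<le> i + 1" "i + 1 < n" using i by auto
  let ?s1 = "swap_entries \<nu> i" and ?s2 = "swap_entries \<nu> (i + 1)"
  note Y1 = swap_entries_fillings[OF YF j(1,2)] and Y2 = swap_entries_fillings[OF YF j(3,4)]
  note Y21 = swap_entries_fillings[OF Y1 j(3,4)] and Y12 = swap_entries_fillings[OF Y2 j(1,2)]
  define x y z where "x = node_of \<nu> Y i" and "y = node_of \<nu> Y (i + 1)" and "z = node_of \<nu> Y (i + 1 + 1)"
  note xyz = x_def[symmetric] y_def[symmetric] z_def[symmetric]
  have reg: "regular x y" "regular y z" "regular x z"
    unfolding x_def y_def z_def using i by (auto intro!: near_entries_regular[OF \<nu> Y])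
  have n1: "node_of \<nu> (?s1 Y) i = y" "node_of \<nu> (?s1 Y) (i + 1) = x" "node_of \<nu> (?s1 Y) (i + 1 + 1) = z"
    using node_of_swap_entries_simps[OF YF j(1,2)] i by (simp_all add: x_def y_def z_def)
  have n2: "node_of \<nu> (?s2 Y) i = x" "node_of \<nu> (?s2 Y) (i + 1) = z" "node_of \<nu> (?s2 Y) (i + 1 + 1) = y"
    using node_of_swap_entries_simps[OF YF j(3,4)] i by (simp_all add: x_def y_def z_def)
  have n21: "node_of \<nu> (?s2 (?s1 Y)) i = y" "node_of \<nu> (?s2 (?s1 Y)) (i + 1) = z"
    using node_of_swap_entries_simps[OF Y1 j(3,4)] i n1 by (simp_all add: x_def y_def z_def)
  have n12: "node_of \<nu> (?s1 (?s2 Y)) (i + 1) = x" "node_of \<nu> (?s1 (?s2 Y)) (i + 1 + 1) = y"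
    using node_of_swap_entries_simps[OF Y2 j(1,2)] i n2 by (simp_all add: x_def y_def z_def)
  note F = sigma_formula[OF \<nu> _ YF j(1,2)] sigma_formula[OF \<nu> _ YF j(3,4)]
    sigma_formula[OF \<nu> _ Y1 j(1,2)] sigma_formula[OF \<nu> _ Y1 j(3,4)]
    sigma_formula[OF \<nu> _ Y2 j(1,2)] sigma_formula[OF \<nu> _ Y2 j(3,4)]
    sigma_formula[OF \<nu> _ Y21 j(1,2)] sigma_formula[OF \<nu> _ Y12 j(3,4)]
  note S = swap_entries_swap_entries[OF YF] swap_entries_braid[symmetric]
  have P: "swap_coeff y x * swap_coeff x y = 1 + \<kappa> * diag_coeff x y - diag_coeff x y * diag_coeff x y"
    "swap_coeff z y * swap_coeff y z = 1 + \<kappa> * diag_coeff y z - diag_coeff y z * diag_coeff y z"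
    using swap_coeff_mult_expand[OF reg(1)] swap_coeff_mult_expand[OF reg(2)]
    by (simp_all add: mult.commute)
  show ?thesis
    unfolding s1_def s2_def F[OF gen_action_closed] F[OF f] n1 n2 n21 n12 xyz S
      diag_coeff_skew[OF reg(1)] diag_coeff_skew[OF reg(2)]
    using P diag_coeff_yang_baxter[OF reg] by (rule braid_identity)
qed

lemma diag_entry_1:
  assumes \<nu>: "\<nu> \<in> multipartitions n" and Y: "Y \<in> standard_mtableaux n \<nu>"
  shows "node_diag (node_of \<nu> Y 1) = 0"
proof -
  have one: "1 \<in> {1..n}" using n_pos by simp
  have "hook (node_of \<nu> Y 1) = {}"
    using hook_standard[OF \<nu> Y one] by simp
  then show ?thesis
    using node_of_positive[OF standard_in_fillings[OF Y] one]
    by (cases "node_of \<nu> Y 1") (auto simp: hook_def node_diag_def)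
qed

lemma tau_polynomial_formula:
  assumes "f \<in> carrier (V_module q v n \<nu>)"
  shows "free_action q v n \<nu> (prod_list (map (\<lambda>j. fa_tau - fa_const (v j)) js)) f Y =
    (\<Prod>j\<leftarrow>js. content (node_of \<nu> Y 1) - v j) * f Y"
proof (induction js)
  case Nil
  then show ?case by (simp add: free_action_one)
next
  case (Cons j js)
  then show ?case
    by (simp add: free_action_mult free_action_diff free_action_gen free_action_const
        tau_formula[OF free_action_closed[OF assms]] algebra_simps)
qed

lemma relators_act_zero:
  assumes \<nu>: "\<nu> \<in> multipartitions n" and f: "f \<in> carrier (V_module q v n \<nu>)"
    and r: "r \<in> hecke_relators q v n"
  shows "free_action q v n \<nu> r f = (\<lambda>Y. 0)"
proof
  fix Y
  show "free_action q v n \<nu> r f Y = 0"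
  proof (cases "Y \<in> standard_mtableaux n \<nu>")
    case False
    then show ?thesis using free_action_closed[OF f] by (simp add: V_module_carrier)
  next
    case Y: True
    note act = free_action_mult free_action_diff free_action_add free_action_gen free_action_const
      free_action_one power2_eq_square
    from r consider
      (braid) i where "1 \<le> i" "i + 1 < n"
        "r = fa_sigma i * fa_sigma (i + 1) * fa_sigma i - fa_sigma (i + 1) * fa_sigma i * fa_sigma (i + 1)"
    | (far) i j where "i \<in> {1..<n}" "j \<in> {1..<n}" "\<bar>int i - int j\<bar> > 1"
        "r = fa_sigma i * fa_sigma j - fa_sigma j * fa_sigma i"
    | (tau_braid) "1 < n"
        "r = fa_tau * fa_sigma 1 * fa_tau * fa_sigma 1 - fa_sigma 1 * fa_tau * fa_sigma 1 * fa_tau"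
    | (tau_sigma) i where "1 < i" "i < n" "r = fa_tau * fa_sigma i - fa_sigma i * fa_tau"
    | (quadratic) i where "1 \<le> i" "i < n" "r = fa_sigma i ^ 2 - (fa_const \<kappa> * fa_sigma i + 1)"
    | (tau) "r = prod_list (map (\<lambda>j. fa_tau - fa_const (v j)) (sorted_list_of_set UNIV))"
      unfolding hecke_relators_def by (auto split: if_splits)
    then show ?thesis
    proof cases
      case braid
      then show ?thesis using braid_relation[OF \<nu> f Y braid(1,2)] by (simp add: act)
    next
      case far
      then show ?thesis using far_relation[OF \<nu> f Y, of i j] by (simp add: act)
    next
      case tau_braid
      then show ?thesis using tau_braid_relation[OF \<nu> f Y tau_braid(1)] by (simp add: act)
    next
      case tau_sigma
      then show ?thesis using tau_sigma_relation[OF \<nu> f Y tau_sigma(1,2)] by (simp add: act)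
    next
      case quadratic
      then show ?thesis using quadratic_relation[OF \<nu> f Y quadratic(1,2)] by (simp add: act)
    next
      case tau
      \<comment> \<open>The entry 1 lies on diagonal 0, so its content is one of the
        \<open>v j\<close>.\<close>
      have "(\<Prod>j\<leftarrow>sorted_list_of_set UNIV. content (node_of \<nu> Y 1) - v j) = 0"
        using diag_entry_1[OF \<nu> Y] by (auto simp: node_content_def prod_list_zero_iff image_iff)
      then show ?thesis using tau tau_polynomial_formula[OF f] by simp
    qed
  qed
qed

lemma left_module_V:
  "\<nu> \<in> multipartitions n \<Longrightarrow> left_module (hecke_algebra q v n) (V_module q v n \<nu>)"
  using relators_act_zero by (intro left_module_V_module)

lemma smult_V:
  assumes "\<nu> \<in> multipartitions n" "f \<in> carrier (free_algebra (hecke_gens n))"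
    "x \<in> carrier (V_module q v n \<nu>)"
  shows "hecke_class q v n f \<odot>\<^bsub>V_module q v n \<nu>\<^esub> x = free_action q v n \<nu> f x"
  using relators_act_zero[OF assms(1)] assms(2,3) by (intro hecke_smult)

subsection \<open>Elements acting diagonally\<close>

text \<open>The same \<open>h\<close> has to work for all shapes \<open>\<nu>\<close> at once; this is what distinguishes the modules
  from each other.\<close>

definition realizes :: "(hecke_gen, 'k) free_alg \<Rightarrow> ((nat \<Rightarrow> 'm mnode) \<Rightarrow> 'k) \<Rightarrow> bool" where
  "realizes h \<phi> \<longleftrightarrow> h \<in> carrier (free_algebra (hecke_gens n)) \<and>
    (\<forall>\<nu>\<in>multipartitions n. \<forall>x\<in>carrier (V_module q v n \<nu>). \<forall>Y.
      free_action q v n \<nu> h x Y = \<phi> (node_of \<nu> Y) * x Y)"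

definition realizable :: "((nat \<Rightarrow> 'm mnode) \<Rightarrow> 'k) \<Rightarrow> bool" where
  "realizable \<phi> \<longleftrightarrow> (\<exists>h. realizes h \<phi>)"

lemma realizesI:
  assumes "h \<in> carrier (free_algebra (hecke_gens n))"
    and "\<And>\<nu> x Y. \<nu> \<in> multipartitions n \<Longrightarrow> x \<in> carrier (V_module q v n \<nu>) \<Longrightarrow>
      Y \<in> standard_mtableaux n \<nu> \<Longrightarrow> free_action q v n \<nu> h x Y = \<phi> (node_of \<nu> Y) * x Y"
  shows "realizes h \<phi>"
  unfolding realizes_def
proof (intro conjI ballI allI assms(1))
  fix \<nu> x Y assume "\<nu> \<in> multipartitions n" and x: "x \<in> carrier (V_module q v n \<nu>)"
  then show "free_action q v n \<nu> h x Y = \<phi> (node_of \<nu> Y) * x Y"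
    using assms(2) free_action_closed[OF x, of h]
    by (cases "Y \<in> standard_mtableaux n \<nu>") (auto simp: V_module_carrier)
qed

lemma realizesD:
  assumes "realizes h \<phi>"
  shows "h \<in> carrier (free_algebra (hecke_gens n))"
    and "\<nu> \<in> multipartitions n \<Longrightarrow> x \<in> carrier (V_module q v n \<nu>) \<Longrightarrow>
      free_action q v n \<nu> h x Y = \<phi> (node_of \<nu> Y) * x Y"
  using assms by (auto simp: realizes_def)

lemma realizes_const: "realizes (fa_const c) (\<lambda>_. c)"
  by (intro realizesI free_algebra_closed) (simp add: free_action_const)

lemma realizes_add: "realizes g \<phi> \<Longrightarrow> realizes h \<psi> \<Longrightarrow> realizes (g + h) (\<lambda>s. \<phi> s + \<psi> s)"
  by (intro realizesI free_algebra_closed)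
     (auto simp: free_action_add realizesD distrib_right)

lemma realizes_mult: "realizes g \<phi> \<Longrightarrow> realizes h \<psi> \<Longrightarrow> realizes (g * h) (\<lambda>s. \<phi> s * \<psi> s)"
  by (intro realizesI free_algebra_closed)
     (auto simp: free_action_mult realizesD free_action_closed mult.assoc)

lemma realizable_const: "realizable (\<lambda>_. c)"
  unfolding realizable_def using realizes_const by blast

lemma realizable_add: "realizable \<phi> \<Longrightarrow> realizable \<psi> \<Longrightarrow> realizable (\<lambda>s. \<phi> s + \<psi> s)"
  unfolding realizable_def using realizes_add by blast

lemma realizable_mult: "realizable \<phi> \<Longrightarrow> realizable \<psi> \<Longrightarrow> realizable (\<lambda>s. \<phi> s * \<psi> s)"
  unfolding realizable_def using realizes_mult by blast

lemma realizable_affine: "realizable \<phi> \<Longrightarrow> realizable (\<lambda>s. (\<phi> s - c) / d)"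
  using realizable_mult[OF realizable_add[OF _ realizable_const[of "- c"]] realizable_const[of "inverse d"], of \<phi>]
  by (simp add: divide_inverse)

lemma realizable_sum:
  "finite A \<Longrightarrow> (\<And>a. a \<in> A \<Longrightarrow> realizable (\<phi> a)) \<Longrightarrow> realizable (\<lambda>s. \<Sum>a\<in>A. \<phi> a s)"
  by (induction A rule: finite_induct) (auto intro: realizable_add realizable_const)

lemma realizable_prod:
  "finite A \<Longrightarrow> (\<And>a. a \<in> A \<Longrightarrow> realizable (\<phi> a)) \<Longrightarrow> realizable (\<lambda>s. \<Prod>a\<in>A. \<phi> a s)"
  by (induction A rule: finite_induct) (auto intro: realizable_mult realizable_const)

text \<open>Conjugation keeps an element diagonal exactly as far as the last factor in front of the
  swapped coordinate vanishes: for contents by \<open>content_skew\<close>, for diagonals only after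
  a correction. The first coefficient is arranged so that its excess over \<open>e b'\<close>
  vanishes for contents by \<open>diag_coeff_content\<close>.\<close>

lemma sigma_conjugate_formula:
  assumes g: "realizes g (\<lambda>s. e (s i))" and i: "1 \<le> i" "i < n"
    and \<nu>: "\<nu> \<in> multipartitions n" and x: "x \<in> carrier (V_module q v n \<nu>)"
    and Y: "Y \<in> standard_mtableaux n \<nu>"
  defines "b \<equiv> node_of \<nu> Y i" and "b' \<equiv> node_of \<nu> Y (i + 1)"
  shows "free_action q v n \<nu> (fa_sigma i * g * fa_sigma i) x Y =
    (e b' + diag_coeff b b' * (diag_coeff b b' * (e b - e b') + \<kappa> * e b')) * x Y +
    swap_coeff b' b * (diag_coeff b b' * e b + diag_coeff b' b * e b') * x (swap_entries \<nu> i Y)"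
proof -
  note YF = standard_in_fillings[OF Y]
  note ZF = swap_entries_fillings[OF YF i]
  have reg: "regular b b'"
    using near_entries_regular[OF \<nu> Y, of i "i + 1"] i by (simp add: b_def b'_def)
  note F = sigma_formula[OF \<nu> _ YF i] sigma_formula[OF \<nu> _ ZF i]
    node_of_swap_entries_simps(1,2)[OF YF i] swap_entries_swap_entries[OF YF] realizesD(2)[OF g \<nu>]
  have "swap_coeff b' b * swap_coeff b b' = 1 + \<kappa> * diag_coeff b b' - diag_coeff b b' * diag_coeff b b'"
    using swap_coeff_mult_expand[OF reg] by (simp add: mult.commute)
  then have *: "swap_coeff b' b * (swap_coeff b b' * w) = (1 + \<kappa> * diag_coeff b b' - diag_coeff b b' * diag_coeff b b') * w" for w
    by (simp flip: mult.assoc)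
  show ?thesis
    unfolding free_action_mult free_action_gen F(1)[OF free_action_closed[OF gen_action_closed]]
      F(6)[OF gen_action_closed] F(1)[OF x] F(2)[OF x] F(3-5) b_def[symmetric] b'_def[symmetric]
    using * [of "e b' * x Y"]
    by (simp add: algebra_simps)
qed

lemma realizable_content:
  assumes "i \<in> {1..n}"
  shows "realizable (\<lambda>s. content (s i))"
proof -
  from assms have "1 \<le> i" "i \<le> n" by auto
  then show ?thesis
  proof (induction i rule: nat_induct_at_least)
    case base
    have "realizes fa_tau (\<lambda>s. content (s 1))"
      by (intro realizesI free_algebra_closed)
        (auto simp: free_action_gen tau_formula hecke_gens_def)
    then show ?case unfolding realizable_def by blast
  next
    case (Suc i)
    then obtain g where g: "realizes g (\<lambda>s. content (s i))" by (auto simp: realizable_def)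
    have i: "1 \<le> i" "i < n" using Suc by auto
    have "realizes (fa_sigma i * g * fa_sigma i) (\<lambda>s. content (s (i + 1)))"
    proof (rule realizesI)
      fix \<nu> x Y assume \<nu>: "\<nu> \<in> multipartitions n" and x: "x \<in> carrier (V_module q v n \<nu>)"
        and Y: "Y \<in> standard_mtableaux n \<nu>"
      have reg: "regular (node_of \<nu> Y i) (node_of \<nu> Y (i + 1))"
        using near_entries_regular[OF \<nu> Y, of i "i + 1"] i by simp
      have "diag_coeff (node_of \<nu> Y i) (node_of \<nu> Y (i + 1)) *
          (content (node_of \<nu> Y i) - content (node_of \<nu> Y (i + 1))) + \<kappa> * content (node_of \<nu> Y (i + 1)) = 0"
        using diag_coeff_content[OF reg] by (metis ab_left_minus minus_diff_eq mult_minus_right)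
      moreover have "diag_coeff (node_of \<nu> Y i) (node_of \<nu> Y (i + 1)) * content (node_of \<nu> Y i) +
          diag_coeff (node_of \<nu> Y (i + 1)) (node_of \<nu> Y i) * content (node_of \<nu> Y (i + 1)) = 0"
        using content_skew[OF reg] by (simp add: mult.commute)
      ultimately show "free_action q v n \<nu> (fa_sigma i * g * fa_sigma i) x Y = content (node_of \<nu> Y (i + 1)) * x Y"
        unfolding sigma_conjugate_formula[OF g i \<nu> x Y] by simp
    qed (use i realizesD(1)[OF g] in \<open>auto intro!: free_algebra_closed simp: hecke_gens_def\<close>)
    then show ?case unfolding realizable_def by auto
  qed
qed

text \<open>For \<open>q\<^sup>2 = 1\<close> the contents only see the components. The diagonals are then the eigenvalues
  of the additive Jucys-Murphy elements of the wreath product.\<close>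

lemma realizable_component:
  assumes "q\<^sup>2 = 1" "i \<in> {1..n}"
  shows "realizable (\<lambda>s. of_bool (fst (s i) = k))"
proof -
  \<comment> \<open>The exponent 0 is in the range of \<open>cross\<close> because n is
    positive.\<close>
  have v: "v j \<noteq> v k" if "j \<noteq> k" for j k
    using cross[OF that, of 0] n_pos by auto
  \<comment> \<open>Lagrange interpolation in the content, which for q^2 = 1 is the parameter of the
    component.\<close>
  have "(\<Prod>j\<in>UNIV - {k}. (content (s i) - v j) / (v k - v j)) = of_bool (fst (s i) = k)" for s
  proof (cases "fst (s i) = k")
    case True
    then have "(\<Prod>j\<in>UNIV - {k}. (content (s i) - v j) / (v k - v j)) = (\<Prod>j\<in>UNIV - {k}. 1)"
      using v[of k] by (intro prod.cong) (auto simp: content_square_1[OF assms(1)])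
    with True show ?thesis by simp
  next
    case False
    then show ?thesis
      by (auto intro!: prod_zero bexI[of _ "fst (s i)"] simp: content_square_1[OF assms(1)])
  qed
  moreover have "realizable (\<lambda>s. \<Prod>j\<in>UNIV - {k}. (content (s i) - v j) / (v k - v j))"
    by (intro realizable_prod realizable_affine realizable_content assms) auto
  ultimately show ?thesis by simp
qed

lemma realizable_same_component:
  assumes "q\<^sup>2 = 1" "i \<in> {1..n}" "j \<in> {1..n}"
  shows "realizable (\<lambda>s. of_bool (fst (s i) = fst (s j)))"
proof -
  have "(\<Sum>k\<in>UNIV. of_bool (fst (s i) = k) * of_bool (fst (s j) = k)) = (of_bool (fst (s i) = fst (s j)) :: 'k)"
    for s :: "nat \<Rightarrow> 'm mnode"
  proof -
    have "(\<Sum>k\<in>UNIV. of_bool (fst (s i) = k) * of_bool (fst (s j) = k)) =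
        (\<Sum>k\<in>UNIV. if k = fst (s i) then of_bool (fst (s i) = fst (s j)) else 0 :: 'k)"
      by (intro sum.cong) auto
    then show ?thesis by simp
  qed
  moreover have "realizable (\<lambda>s. \<Sum>k\<in>UNIV. of_bool (fst (s i) = k) * of_bool (fst (s j) = k))"
    by (intro realizable_sum realizable_mult realizable_component assms) auto
  ultimately show ?thesis by simp
qed

lemma realizable_diag:
  assumes sq: "q\<^sup>2 = 1" and "i \<in> {1..n}"
  shows "realizable (\<lambda>s. of_int (node_diag (s i)))"
proof -
  have qq: "q * q = 1" using sq by (simp add: power2_eq_square)
  have inv: "inverse q = q" using qq q_nonzero by (simp add: field_simps)
  from assms have "1 \<le> i" "i \<le> n" by auto
  then show ?thesis
  proof (induction i rule: nat_induct_at_least)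
    case base
    have "realizes 0 (\<lambda>s. of_int (node_diag (s 1)))"
    proof (rule realizesI)
      fix \<nu> :: "'m \<Rightarrow> nat list" and x Y
      assume \<nu>: "\<nu> \<in> multipartitions n" and Y: "Y \<in> standard_mtableaux n \<nu>"
      have "node_diag (node_of \<nu> Y 1) = 0"
        using diag_entry_1[OF \<nu> Y] .
      then show "free_action q v n \<nu> 0 x Y = of_int (node_diag (node_of \<nu> Y 1)) * x Y"
        by (simp add: free_action_zero)
    qed (simp add: free_algebra_def)
    then show ?case unfolding realizable_def by blast
  next
    case (Suc i)
    then obtain g where g: "realizes g (\<lambda>s. of_int (node_diag (s i)))" by (auto simp: realizable_def)
    have i: "1 \<le> i" "i < n" using Suc by auto
    then obtain p where p: "realizes p (\<lambda>s. of_bool (fst (s i) = fst (s (i + 1))))"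
      using realizable_same_component[OF sq, of i "i + 1"] by (auto simp: realizable_def)
    \<comment> \<open>The eigenvalue of \<open>p\<close> is symmetric in the two nodes, hence the
      same at a filling and at its swap, so the second summand is q times \<sigma> scaled by it. It
      cancels the off-diagonal part of the first summand.\<close>
    let ?h = "fa_sigma i * g * fa_sigma i + fa_const q * fa_sigma i * p"
    have "realizes ?h (\<lambda>s. of_int (node_diag (s (i + 1))))"
    proof (rule realizesI)
      fix \<nu> x Y assume \<nu>: "\<nu> \<in> multipartitions n" and x: "x \<in> carrier (V_module q v n \<nu>)"
        and Y: "Y \<in> standard_mtableaux n \<nu>"
      note YF = standard_in_fillings[OF Y]
      define b b' where "b = node_of \<nu> Y i" and "b' = node_of \<nu> Y (i + 1)"
      define e e' :: 'k where "e = of_int (node_diag b)" and "e' = of_int (node_diag b')"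
      define d :: 'k where "d = of_bool (fst b = fst b')"
      have reg: "regular b b'"
        using near_entries_regular[OF \<nu> Y, of i "i + 1"] i by (simp add: b_def b'_def)
      have d': "of_bool (fst b' = fst b) = d" by (simp add: d_def eq_commute)
      \<comment> \<open>The additive counterpart of \<open>diag_coeff_content\<close>: the limiting
        coefficient is q / (e' - e) inside a component and 0 across components.\<close>
      have "diag_coeff b b' * (e' - e) = q * d"
      proof (cases "content b = content b'")
        case True
        note regular_content_eqD[OF reg True]
        then show ?thesis
          by (simp add: diag_coeff_eq[OF True] e_def e'_def d_def)
      next
        case False
        then have "fst b \<noteq> fst b'" by (auto simp: content_square_1[OF sq])
        then show ?thesis using False by (simp add: sigma_diag_coeff_def inv d_def Let_def)
      qed
      then have a: "diag_coeff b b' * e = diag_coeff b b' * e' - q * d"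
        by (simp add: algebra_simps)
      have skew: "diag_coeff b' b = - diag_coeff b b'"
        using diag_coeff_skew[OF reg] inv by simp
      have "free_action q v n \<nu> (fa_const q * fa_sigma i * p) x Y =
          q * (diag_coeff b b' * (d * x Y) + swap_coeff b' b * (d * x (swap_entries \<nu> i Y)))"
        unfolding free_action_mult free_action_gen free_action_const
          sigma_formula[OF \<nu> free_action_closed[OF x] YF i] realizesD(2)[OF p \<nu> x]
          node_of_swap_entries_simps(1,2)[OF YF i] b_def[symmetric] b'_def[symmetric] d' d_def ..
      moreover have "free_action q v n \<nu> (fa_sigma i * g * fa_sigma i) x Y =
          (e' + diag_coeff b b' * (diag_coeff b b' * (e - e') + \<kappa> * e')) * x Y +
          swap_coeff b' b * (diag_coeff b b' * e + diag_coeff b' b * e') * x (swap_entries \<nu> i Y)"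
        using sigma_conjugate_formula[OF g i \<nu> x Y] unfolding b_def b'_def e_def e'_def .
      ultimately have "free_action q v n \<nu> ?h x Y = e' * x Y"
        unfolding free_action_add skew right_diff_distrib a inv by (simp add: algebra_simps)
      then show "free_action q v n \<nu> ?h x Y = of_int (node_diag (node_of \<nu> Y (i + 1))) * x Y"
        by (simp add: e'_def b'_def)
    qed (use i realizesD(1)[OF g] realizesD(1)[OF p] in \<open>auto intro!: free_algebra_closed simp: hecke_gens_def\<close>)
    then show ?case unfolding realizable_def by auto
  qed
qed

text \<open>At the first difference both nodes have their hooks in the common initial segment, so
  the bounds for nodes of a single tableau apply even across shapes. If the contents agree,
  regularity leaves q^2 = 1 and diagonals that differ in the field.\<close>

lemma separating_element:
  assumes \<nu>: "\<nu> \<in> multipartitions n" and X: "X \<in> standard_mtableaux n \<nu>"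
    and \<mu>: "\<mu> \<in> multipartitions n" and Y: "Y \<in> standard_mtableaux n \<mu>"
    and "(\<nu>, X) \<noteq> (\<mu>, Y)"
  obtains \<phi> where "realizable \<phi>" "\<phi> (node_of \<nu> X) \<noteq> \<phi> (node_of \<mu> Y)"
proof -
  obtain i where i: "i \<in> {1..n}"
    and before: "\<And>j. j \<in> {1..<i} \<Longrightarrow> node_of \<nu> X j = node_of \<mu> Y j"
    and diag: "fst (node_of \<nu> X i) = fst (node_of \<mu> Y i) \<Longrightarrow>
      node_diag (node_of \<nu> X i) \<noteq> node_diag (node_of \<mu> Y i)"
    using first_difference[OF assms] by metis
  let ?S = "node_of \<nu> X ` {1..<i}" and ?x = "node_of \<nu> X i" and ?y = "node_of \<mu> Y i"
  have "node_of \<mu> Y ` {1..<i} = ?S" using before by auto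
  then have hooks: "hook ?x \<subseteq> ?S" "hook ?y \<subseteq> ?S"
    using hook_standard[OF \<nu> X i] hook_standard[OF \<mu> Y i] by auto
  note pos = node_of_positive[OF standard_in_fillings[OF X] i] node_of_positive[OF standard_in_fillings[OF Y] i]
  have "card ?S \<le> card {1..<i}" by (rule card_image_le) simp
  then have card: "int (card ?S) \<le> int n - 1" using i by auto
  have reg: "regular ?x ?y"
  proof (rule regularI)
    assume same: "fst ?x = fst ?y"
    from hook_diag_same_component[OF _ hooks same pos] card diag[OF same]
    show "node_diag ?x \<noteq> node_diag ?y \<and> \<bar>node_diag ?x - node_diag ?y\<bar> \<le> int n" by simp
  next
    assume "fst ?x \<noteq> fst ?y"
    from hook_diag_distinct_components[OF _ hooks this pos] card
    show "\<bar>node_diag ?x - node_diag ?y\<bar> < int n" by simp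
  qed
  show thesis
  proof (cases "content ?x = content ?y")
    case False
    with that[OF realizable_content[OF i]] show thesis .
  next
    case True
    note D = regular_content_eqD[OF reg True]
    from that[OF realizable_diag[OF D(1) i] D(4)] show thesis .
  qed
qed

text \<open>Multiplies one interpolation factor per pair in \<open>F\<close>. Indexing by pairs
  allows the other tableaux of the same shape (for irreducibility) and all tableaux of another shape
  (for inequivalence).\<close>

lemma projector:
  assumes \<nu>: "\<nu> \<in> multipartitions n" and X: "X \<in> standard_mtableaux n \<nu>"
    and "finite F" "\<And>\<mu> Y. (\<mu>, Y) \<in> F \<Longrightarrow>
      \<mu> \<in> multipartitions n \<and> Y \<in> standard_mtableaux n \<mu> \<and> (\<nu>, X) \<noteq> (\<mu>, Y)"
  obtains h \<phi> where "realizes h \<phi>" "\<phi> (node_of \<nu> X) = 1" "\<And>\<mu> Y. (\<mu>, Y) \<in> F \<Longrightarrow> \<phi> (node_of \<mu> Y) = 0"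
proof -
  have "\<exists>\<phi>. realizable \<phi> \<and> \<phi> (node_of \<nu> X) = 1 \<and> (\<forall>(\<mu>, Y)\<in>F. \<phi> (node_of \<mu> Y) = 0)"
    using assms(3,4)
  proof (induction F rule: finite_induct)
    case empty
    then show ?case using realizable_const[of 1] by auto
  next
    case (insert p F)
    then obtain \<phi> where \<phi>: "realizable \<phi>" "\<phi> (node_of \<nu> X) = 1" "\<forall>(\<mu>, Y)\<in>F. \<phi> (node_of \<mu> Y) = 0"
      by (metis insertCI)
    obtain \<mu> Y where p: "p = (\<mu>, Y)" by (cases p)
    with insert.prems have Y: "\<mu> \<in> multipartitions n" "Y \<in> standard_mtableaux n \<mu>" "(\<nu>, X) \<noteq> (\<mu>, Y)"
      by auto
    obtain \<psi> where \<psi>: "realizable \<psi>" "\<psi> (node_of \<nu> X) \<noteq> \<psi> (node_of \<mu> Y)"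
      using separating_element[OF \<nu> X Y] by metis
    let ?\<chi> = "\<lambda>s. \<phi> s * ((\<psi> s - \<psi> (node_of \<mu> Y)) / (\<psi> (node_of \<nu> X) - \<psi> (node_of \<mu> Y)))"
    have "realizable ?\<chi>" by (intro realizable_mult realizable_affine \<phi> \<psi>)
    moreover have "?\<chi> (node_of \<nu> X) = 1" using \<phi> \<psi> by simp
    moreover have "\<forall>(\<mu>, Y)\<in>insert p F. ?\<chi> (node_of \<mu> Y) = 0" using \<phi> p by auto
    ultimately show ?case by blast
  qed
  then show thesis using that unfolding realizable_def by blast
qed

subsection \<open>Irreducibility and pairwise inequivalence\<close>

lemma basis_vec_carrier: "X \<in> standard_mtableaux n \<nu> \<Longrightarrow> basis_vec X \<in> carrier (V_module q v n \<nu>)"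
  by (auto simp: V_module_carrier basis_vec_def)

text \<open>The coefficient vanishes only where the contents behave like those of nodes whose
  diagonals differ by d + 1 instead of d. This shift is affordable: either node can carry i in a
  standard tableau with the same smaller entries, so both hooks fit into i - 1 nodes, at most n -
  2.\<close>

lemma swap_coeff_neq_0:
  assumes \<nu>: "\<nu> \<in> multipartitions n" and X: "X \<in> standard_mtableaux n \<nu>" and i: "1 \<le> i" "i < n"
    and Z: "swap_entries \<nu> i X \<in> standard_mtableaux n \<nu>"
  shows "swap_coeff (node_of \<nu> X i) (node_of \<nu> X (i + 1)) \<noteq> 0"
proof -
  note XF = standard_in_fillings[OF X]
  let ?x = "node_of \<nu> X i" and ?y = "node_of \<nu> X (i + 1)"
  let ?S = "node_of \<nu> X ` {1..<i}"
  have ij: "i \<in> {1..n}" "i + 1 \<in> {1..n}" using i by auto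
  have reg: "regular ?x ?y" using near_entries_regular[OF \<nu> X ij] by simp
  have "node_of \<nu> (swap_entries \<nu> i X) ` {1..<i} = ?S"
    using i by (intro image_cong refl node_of_swap_entries_simps(3)[OF XF i]) auto
  then have hooks: "hook ?x \<subseteq> ?S" "hook ?y \<subseteq> ?S"
    using hook_standard[OF \<nu> X ij(1)] hook_standard[OF \<nu> Z ij(1)]
      node_of_swap_entries_simps(1)[OF XF i] by auto
  have "card ?S \<le> card {1..<i}" by (rule card_image_le) simp
  then have card: "int (card ?S) \<le> int n - 2" using i by auto
  note pos = node_of_positive[OF XF ij(1)] node_of_positive[OF XF ij(2)]
  have not_le: "\<not> node_le ?x ?y" "\<not> node_le ?y ?x"
    using swap_entries_standard_iff[OF \<nu> X i] swap_entries_standard_iff[OF \<nu> Z i] X Z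
      node_of_swap_entries_simps(1,2)[OF XF i] swap_entries_swap_entries[OF XF] by auto
  have not_adj: "\<not> node_adj ?x ?y" "\<not> node_adj ?y ?x"
    using not_le by (auto simp: node_adj_def node_le_def)
  let ?d = "node_diag ?y - node_diag ?x"
  have same: "?d + 1 \<noteq> 0 \<and> \<bar>?d + 1\<bar> \<le> int n" if "fst ?x = fst ?y"
  proof
    \<comment> \<open>Incomparable nodes of one component are at least two diagonals apart.\<close>
    show "?d + 1 \<noteq> 0"
      using not_le that by (auto simp: node_le_def node_diag_def split: prod.splits)
    show "\<bar>?d + 1\<bar> \<le> int n"
      using hook_diag_same_component[OF _ hooks that pos] card by simp
  qed
  have "diag_coeff ?x ?y + inverse q \<noteq> 0"
  proof (cases "content ?x = content ?y")
    case True
    note D = regular_content_eqD[OF reg True]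
    have ne: "(of_int (node_diag ?y) - of_int (node_diag ?x) :: 'k) \<noteq> 0" using D(4) by simp
    have "of_int (?d + 1) \<noteq> (0 :: 'k)"
      using of_int_neq_0[OF D(1), of "?d + 1"] same[OF D(3)] by blast
    moreover have "diag_coeff ?x ?y + inverse q =
        q * of_int (?d + 1) / (of_int (node_diag ?y) - of_int (node_diag ?x))"
      using ne unfolding diag_coeff_eq[OF True] D(2) by (simp add: field_simps)
    ultimately show ?thesis using q_nonzero ne by simp
  next
    case False
    have eq: "(diag_coeff ?x ?y + inverse q) * (content ?y - content ?x) = q * content ?y - inverse q * content ?x"
      using diag_coeff_content[OF reg] by (simp add: algebra_simps)
    have "q * content ?y - inverse q * content ?x \<noteq> 0"
    proof
      assume "q * content ?y - inverse q * content ?x = 0"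
      then have "q\<^sup>2 * content ?y = content ?x"
        using q_nonzero by (simp add: field_simps power2_eq_square)
      then have E: "q powi (2 * (?d + 1)) * v (fst ?y) = v (fst ?x)"
        using q_nonzero by (simp add: node_content_def distrib_left right_diff_distrib
            power_int_add power_int_diff field_simps)
      show False
      proof (cases "fst ?x = fst ?y")
        case True
        then have "q powi (2 * (?d + 1)) = 1" using E v_nonzero by simp
        moreover have "q\<^sup>2 \<noteq> 1" using False True by (auto simp: content_square_1)
        ultimately show False using powi_neq_1 same[OF True] by blast
      next
        case False
        have "\<bar>?d + 1\<bar> < int n"
          using hook_diag_distinct_components[OF _ hooks False pos] card by simp
        then show False
          using cross[of "fst ?y" "fst ?x" "?d + 1"] False E by (simp add: abs_less_iff)
      qed
    qed
    with eq show ?thesis by auto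
  qed
  then show ?thesis using not_adj by (simp add: swap_coeff_def)
qed

lemma submodule_V_closed:
  assumes \<nu>: "\<nu> \<in> multipartitions n" and N: "submodule N (hecke_algebra q v n) (V_module q v n \<nu>)"
  shows "N \<subseteq> carrier (V_module q v n \<nu>)"
    and "(\<lambda>Y. 0) \<in> N"
    and "x \<in> N \<Longrightarrow> y \<in> N \<Longrightarrow> (\<lambda>Y. x Y + y Y) \<in> N"
    and "x \<in> N \<Longrightarrow> f \<in> carrier (free_algebra (hecke_gens n)) \<Longrightarrow> free_action q v n \<nu> f x \<in> N"
    and "x \<in> N \<Longrightarrow> (\<lambda>Y. c * x Y) \<in> N"
proof -
  interpret submodule N "hecke_algebra q v n" "V_module q v n \<nu>" by (rule N)
  show sub: "N \<subseteq> carrier (V_module q v n \<nu>)" using subset by simp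
  show "(\<lambda>Y. 0) \<in> N" using one_closed by simp
  show "(\<lambda>Y. x Y + y Y) \<in> N" if "x \<in> N" "y \<in> N" using m_closed[OF that] by simp
  show act: "free_action q v n \<nu> f x \<in> N" if "x \<in> N" "f \<in> carrier (free_algebra (hecke_gens n))" for f
  proof -
    have "hecke_class q v n f \<in> carrier (hecke_algebra q v n)"
      using that(2) by (simp add: carrier_hecke_algebra)
    moreover have "hecke_class q v n f \<odot>\<^bsub>V_module q v n \<nu>\<^esub> x = free_action q v n \<nu> f x"
      using sub that(1) by (intro smult_V[OF \<nu> that(2)]) blast
    ultimately show ?thesis
      using smult_closed[of "hecke_class q v n f" x] that(1) by metis
  qed
  show "(\<lambda>Y. c * x Y) \<in> N" if "x \<in> N"
    using act[OF that free_algebra_closed(5)[of c]] by (simp add: free_action_const)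
qed

lemma irreducible_V:
  assumes \<nu>: "\<nu> \<in> multipartitions n"
  shows "irreducible_left_module (hecke_algebra q v n) (V_module q v n \<nu>)"
  unfolding irreducible_left_module_def
proof (intro conjI allI impI left_module_V[OF \<nu>])
  obtain X where X: "X \<in> standard_mtableaux n \<nu>" using standard_exists[OF \<nu>] by blast
  have "basis_vec X \<noteq> (\<lambda>Y. 0 :: 'k)"
    by (metis basis_vec_def zero_neq_one)
  with basis_vec_carrier[OF X]
  show "carrier (V_module q v n \<nu>) \<noteq> {\<zero>\<^bsub>V_module q v n \<nu>\<^esub>}" by auto
next
  fix N assume N: "submodule N (hecke_algebra q v n) (V_module q v n \<nu>)"
  note closed = submodule_V_closed[OF \<nu> N]
  show "N = {\<zero>\<^bsub>V_module q v n \<nu>\<^esub>} \<or> N = carrier (V_module q v n \<nu>)"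
  proof (rule disjCI)
    assume "N \<noteq> carrier (V_module q v n \<nu>)"
    show "N = {\<zero>\<^bsub>V_module q v n \<nu>\<^esub>}"
    proof (rule ccontr)
      assume "N \<noteq> {\<zero>\<^bsub>V_module q v n \<nu>\<^esub>}"
      then obtain x where x: "x \<in> N" "x \<noteq> (\<lambda>Y. 0)" using closed(2) by auto
      then obtain X where X: "x X \<noteq> 0" by blast
      have xV: "x \<in> carrier (V_module q v n \<nu>)" using x closed(1) by blast
      with X have XT: "X \<in> standard_mtableaux n \<nu>" by (auto simp: V_module_carrier)
      obtain h \<phi> where h: "realizes h \<phi>" "\<phi> (node_of \<nu> X) = 1"
        "\<And>\<mu> Y. (\<mu>, Y) \<in> {\<nu>} \<times> (standard_mtableaux n \<nu> - {X}) \<Longrightarrow> \<phi> (node_of \<mu> Y) = 0"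
        using projector[OF \<nu> XT, of "{\<nu>} \<times> (standard_mtableaux n \<nu> - {X})"] \<nu>
          finite_standard_mtableaux[of n \<nu>] by blast
      \<comment> \<open>The projector isolates one nonzero coordinate of \<open>x\<close>.\<close>
      have "free_action q v n \<nu> h x Y = x X * basis_vec X Y" for Y
        using realizesD(2)[OF h(1) \<nu> xV, of Y] h(2) h(3)[of \<nu> Y] xV
        by (cases "Y = X"; cases "Y \<in> standard_mtableaux n \<nu>") (auto simp: basis_vec_def V_module_carrier)
      then have "free_action q v n \<nu> h x = (\<lambda>Y. x X * basis_vec X Y)" by blast
      then have "(\<lambda>Y. x X * basis_vec X Y) \<in> N"
        using closed(4)[OF x(1) realizesD(1)[OF h(1)]] by simp
      from closed(5)[OF this, of "inverse (x X)"] X have base: "basis_vec X \<in> N"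
        by (simp flip: mult.assoc)
      \<comment> \<open>Membership of basis vectors spreads along admissible swaps, starting from
        the isolated one.\<close>
      have basis: "basis_vec Y \<in> N" if Y: "Y \<in> standard_mtableaux n \<nu>" for Y
      proof (rule standard_connected[OF \<nu> XT Y, where P = "\<lambda>Y. basis_vec Y \<in> N"])
        fix Z i assume Z: "Z \<in> standard_mtableaux n \<nu>" and b: "basis_vec Z \<in> N"
          and i: "1 \<le> i" "i < n" and sZ: "swap_entries \<nu> i Z \<in> standard_mtableaux n \<nu>"
        let ?x = "node_of \<nu> Z i" and ?y = "node_of \<nu> Z (i + 1)"
        note ZF = standard_in_fillings[OF Z]
        have act: "free_action q v n \<nu> (fa_sigma i) (basis_vec Z) W =
            diag_coeff ?x ?y * basis_vec Z W + swap_coeff ?x ?y * basis_vec (swap_entries \<nu> i Z) W" for W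
        proof (cases "W \<in> standard_mtableaux n \<nu>")
          case W: True
          note WF = standard_in_fillings[OF W]
          have "swap_entries \<nu> i W = Z \<longleftrightarrow> W = swap_entries \<nu> i Z"
            using swap_entries_swap_entries[OF WF] swap_entries_swap_entries[OF ZF] by metis
          then show ?thesis
            using node_of_swap_entries_simps(1,2)[OF ZF i]
            unfolding free_action_gen sigma_formula[OF \<nu> basis_vec_carrier[OF Z] WF i]
            by (auto simp: basis_vec_def)
        next
          case False
          then show ?thesis
            using Z sZ by (auto simp: free_action_gen gen_action_supported basis_vec_def)
        qed
        have "fa_sigma i \<in> carrier (free_algebra (hecke_gens n) :: (_, 'k) free_alg ring)"
          using i by (intro free_algebra_closed) (simp add: hecke_gens_def)
        \<comment> \<open>Subtracting the diagonal term leaves a nonzero multiple of the swapped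
          basis vector.\<close>
        from closed(4)[OF b this]
        have "(\<lambda>W. free_action q v n \<nu> (fa_sigma i) (basis_vec Z) W + (- diag_coeff ?x ?y) * basis_vec Z W) \<in> N"
          using closed(5)[OF b] by (intro closed(3))
        then have "(\<lambda>W. swap_coeff ?x ?y * basis_vec (swap_entries \<nu> i Z) W) \<in> N"
          by (simp add: act)
        from closed(5)[OF this, of "inverse (swap_coeff ?x ?y)"] swap_coeff_neq_0[OF \<nu> Z i sZ]
        show "basis_vec (swap_entries \<nu> i Z) \<in> N" by (simp flip: mult.assoc)
      qed (rule base)
      have "y \<in> N" if y: "y \<in> carrier (V_module q v n \<nu>)" for y
      proof -
        have "(\<lambda>Y. \<Sum>Z\<in>A. y Z * basis_vec Z Y) \<in> N" if "finite A" "A \<subseteq> standard_mtableaux n \<nu>" for A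
          using that
        proof (induction A rule: finite_induct)
          case (insert Z A)
          then have "(\<lambda>Y. y Z * basis_vec Z Y + (\<Sum>Z\<in>A. y Z * basis_vec Z Y)) \<in> N"
            by (intro closed(3) closed(5) basis) auto
          with insert show ?case by simp
        qed (simp add: closed(2))
        from this[OF finite_standard_mtableaux order_refl]
        have "(\<lambda>Y. \<Sum>Z\<in>standard_mtableaux n \<nu>. y Z * basis_vec Z Y) \<in> N" .
        moreover have "(\<Sum>Z\<in>standard_mtableaux n \<nu>. y Z * basis_vec Z Y) = y Y" for Y
        proof -
          have "(\<Sum>Z\<in>standard_mtableaux n \<nu>. y Z * basis_vec Z Y) =
              (\<Sum>Z\<in>standard_mtableaux n \<nu>. if Z = Y then y Y else 0)"
            by (intro sum.cong) (auto simp: basis_vec_def)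
          then show ?thesis
            using y by (auto simp: finite_standard_mtableaux V_module_carrier)
        qed
        ultimately show ?thesis by simp
      qed
      with closed(1) \<open>N \<noteq> carrier _\<close> show False by blast
    qed
  qed
qed

text \<open>Some element of the algebra fixes a basis vector of one module and annihilates the other
  module. An isomorphism would therefore send this basis vector to 0, against injectivity.\<close>

lemma not_isomorphic_V:
  assumes \<nu>: "\<nu> \<in> multipartitions n" and \<mu>: "\<mu> \<in> multipartitions n" and "\<nu> \<noteq> \<mu>"
  shows "\<not> isomorphic_left_modules (hecke_algebra q v n) (V_module q v n \<nu>) (V_module q v n \<mu>)"
proof
  assume "isomorphic_left_modules (hecke_algebra q v n) (V_module q v n \<nu>) (V_module q v n \<mu>)"
  then obtain F where bij: "bij_betw F (carrier (V_module q v n \<nu>)) (carrier (V_module q v n \<mu>))"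
    and smult: "\<And>a x. a \<in> carrier (hecke_algebra q v n) \<Longrightarrow> x \<in> carrier (V_module q v n \<nu>) \<Longrightarrow>
      F (a \<odot>\<^bsub>V_module q v n \<nu>\<^esub> x) = a \<odot>\<^bsub>V_module q v n \<mu>\<^esub> F x"
    by (auto simp: isomorphic_left_modules_def left_module_iso_def)
  have act: "F (free_action q v n \<nu> f x) = free_action q v n \<mu> f (F x)"
    if "f \<in> carrier (free_algebra (hecke_gens n))" "x \<in> carrier (V_module q v n \<nu>)" for f x
  proof -
    have "hecke_class q v n f \<in> carrier (hecke_algebra q v n)"
      using that(1) by (simp add: carrier_hecke_algebra)
    from smult[OF this that(2)] show ?thesis
      using smult_V[OF \<nu> that] smult_V[OF \<mu> that(1)] bij_betwE[OF bij] that(2) by simp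
  qed
  obtain X where X: "X \<in> standard_mtableaux n \<nu>" using standard_exists[OF \<nu>] by blast
  note bX = basis_vec_carrier[OF X]
  obtain h \<phi> where h: "realizes h \<phi>" "\<phi> (node_of \<nu> X) = 1"
    "\<And>\<rho> Y. (\<rho>, Y) \<in> {\<mu>} \<times> standard_mtableaux n \<mu> \<Longrightarrow> \<phi> (node_of \<rho> Y) = 0"
    using projector[OF \<nu> X, of "{\<mu>} \<times> standard_mtableaux n \<mu>"] \<mu> \<open>\<nu> \<noteq> \<mu>\<close>
      finite_standard_mtableaux[of n \<mu>] by blast
  have FX: "F (basis_vec X) \<in> carrier (V_module q v n \<mu>)" using bij_betwE[OF bij] bX by blast
  have "free_action q v n \<nu> h (basis_vec X) = basis_vec X"
    using realizesD(2)[OF h(1) \<nu> bX] h(2) by (auto simp: basis_vec_def)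
  moreover have "free_action q v n \<mu> h (F (basis_vec X)) = (\<lambda>Y. 0)"
  proof
    fix Y
    show "free_action q v n \<mu> h (F (basis_vec X)) Y = 0"
      using realizesD(2)[OF h(1) \<mu> FX, of Y] h(3)[of \<mu> Y] FX
      by (cases "Y \<in> standard_mtableaux n \<mu>") (auto simp: V_module_carrier)
  qed
  ultimately have "F (basis_vec X) = (\<lambda>Y. 0)"
    using act[OF realizesD(1)[OF h(1)] bX] by simp
  moreover have zero: "(\<lambda>Y. 0) \<in> carrier (V_module q v n \<nu>)" by (simp add: V_module_carrier)
  have "F (\<lambda>Y. 0) = (\<lambda>Y. 0)"
    using act[OF free_algebra_closed(5)[of 0] zero] by (simp add: free_action_const)
  ultimately have "basis_vec X = (\<lambda>Y. 0 :: 'k)"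
    using bij_betw_imp_inj_on[OF bij] bX zero by (metis inj_onD)
  then show False by (metis basis_vec_def zero_neq_one)
qed

end

section \<open>Generic parameters\<close>

lemma indet_power: "indet p ^ i = Fract (Poly_Mapping.single (Poly_Mapping.single p i) 1) 1"
proof (induction i)
  case 0
  then show ?case by (simp add: One_fract_def)
next
  case (Suc i)
  have "Poly_Mapping.single p (Suc i) = Poly_Mapping.single p 1 + Poly_Mapping.single p i"
    by (simp flip: single_add)
  with Suc show ?case by (simp add: indet_def mult_single)
qed

lemma indet_power_mult:
  "indet None ^ i * indet (Some j) =
    Fract (Poly_Mapping.single (Poly_Mapping.single None i + Poly_Mapping.single (Some j) 1) 1) 1"
  unfolding indet_power by (simp add: indet_def mult_single)

lemma indet_power_mult_neq:
  assumes "j \<noteq> k"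
  shows "indet None ^ i * indet (Some j) \<noteq> indet (Some k)"
proof
  assume "indet None ^ i * indet (Some j) = indet (Some k)"
  then have "Fract (Poly_Mapping.single (Poly_Mapping.single None i + Poly_Mapping.single (Some j) 1) 1) 1 =
      Fract (Poly_Mapping.single (Poly_Mapping.single (Some k) (1::nat)) (1::complex)) 1"
    unfolding indet_power_mult by (simp add: indet_def)
  then have "Poly_Mapping.single (Poly_Mapping.single None i + Poly_Mapping.single (Some j) 1) (1::complex) =
      Poly_Mapping.single (Poly_Mapping.single (Some k) (1::nat)) 1"
    by (simp add: eq_fract)
  then have "Poly_Mapping.single None i + Poly_Mapping.single (Some j) 1 = Poly_Mapping.single (Some k) (1::nat)"
    by (metis keys_single singleton_inject zero_neq_one)
  \<comment> \<open>The exponent of the indeterminate v_k is 0 on the left and 1 on the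
    right.\<close>
  then have "Poly_Mapping.lookup (Poly_Mapping.single None i + Poly_Mapping.single (Some j) 1) (Some k) =
      Poly_Mapping.lookup (Poly_Mapping.single (Some k) (1::nat)) (Some k)"
    by simp
  with assms show False by (simp add: lookup_add lookup_single)
qed

lemma indet_nonzero: "indet p \<noteq> 0"
  by (simp add: indet_def Zero_fract_def eq_fract)
     (metis keys_single keys_zero singleton_insert_inj_eq' insert_not_empty zero_neq_one)

lemma sum_indet_power:
  "(\<Sum>i\<le>N. indet None ^ (2 * i)) = Fract (\<Sum>i\<le>N. Poly_Mapping.single (Poly_Mapping.single None (2 * i)) 1) 1"
  by (induction N) (simp_all add: indet_power One_fract_def)

lemma admissible_generic:
  assumes "1 \<le> n"
  shows "admissible (generic_q :: 'm::{finite,linorder} generic_field) generic_v n"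
proof
  show "1 \<le> n" by (rule assms)
  show "(generic_q :: 'm generic_field) \<noteq> 0" "generic_v j \<noteq> (0 :: 'm generic_field)" for j
    by (simp_all add: generic_q_def generic_v_def indet_nonzero)
  show "(\<Sum>i\<le>N. (generic_q :: 'm generic_field) ^ (2 * i)) \<noteq> 0" for N
  proof
    assume "(\<Sum>i\<le>N. (generic_q :: 'm generic_field) ^ (2 * i)) = 0"
    then have "(\<Sum>i\<le>N. Poly_Mapping.single (Poly_Mapping.single (None :: 'm option) (2 * i)) (1::complex)) = 0"
      unfolding generic_q_def sum_indet_power by (simp add: Zero_fract_def eq_fract)
    \<comment> \<open>In the constant coefficient only the summand for i = 0 survives, with value
      1.\<close>
    then have "(\<Sum>i\<le>N. Poly_Mapping.lookup (Poly_Mapping.single (Poly_Mapping.single (None :: 'm option) (2 * i)) (1::complex)) 0) = 0"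
      by (metis lookup_sum lookup_zero)
    moreover have "Poly_Mapping.single (None :: 'm option) (2 * i) = 0 \<longleftrightarrow> i = 0" for i :: nat
      by (metis mult_eq_0_iff single_zero lookup_single_eq lookup_zero zero_neq_numeral)
    ultimately show False by (simp add: lookup_single when_def)
  qed
  show "(generic_q :: 'm generic_field) powi (2 * i) * generic_v j - generic_v k \<noteq> 0" if "j \<noteq> k" for i j k
  proof
    assume eq: "(generic_q :: 'm generic_field) powi (2 * i) * generic_v j - generic_v k = 0"
    show False
    proof (cases "0 \<le> i")
      case True
      then show False
        using eq indet_power_mult_neq[OF that, of "nat (2 * i)"]
        by (simp add: power_int_def generic_q_def generic_v_def)
    next
      case False
      \<comment> \<open>Clearing the negative power of q exchanges the roles of j and k.\<close>
      then have "generic_v j = (generic_q :: 'm generic_field) ^ nat (- (2 * i)) * generic_v k"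
        using eq indet_nonzero[of "None :: 'm option"]
        by (simp add: power_int_def generic_q_def power_inverse field_simps)
      then show False
        using indet_power_mult_neq[OF that[symmetric], of "nat (- (2 * i))"]
        by (simp add: generic_q_def generic_v_def)
    qed
  qed
qed

lemma admissible_complex:
  assumes "1 \<le> n" "admissible_parameters q v n"
  shows "admissible q v n"
  using assms by unfold_locales (auto simp: admissible_parameters_def)

theorem theorem14:
  fixes n :: nat
  assumes "n \<ge> 1"
  shows
    "((\<forall>\<nu>\<in>multipartitions n.
         irreducible_left_module
           (hecke_algebra generic_q (generic_v :: 'm::{finite,linorder} \<Rightarrow> _) n)
           (V_module generic_q generic_v n \<nu>)) \<and>
      (\<forall>\<nu>\<in>multipartitions n. \<forall>\<mu>\<in>multipartitions n. \<nu> \<noteq> \<mu> \<longrightarrow>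
         \<not> isomorphic_left_modules
             (hecke_algebra generic_q (generic_v :: 'm \<Rightarrow> _) n)
             (V_module generic_q generic_v n \<nu>) (V_module generic_q generic_v n \<mu>))) \<and>
     (\<forall>(q::complex) (v :: 'm \<Rightarrow> complex). admissible_parameters q v n \<longrightarrow>
        (\<forall>\<nu>\<in>multipartitions n.
           irreducible_left_module (hecke_algebra q v n) (V_module q v n \<nu>)) \<and>
        (\<forall>\<nu>\<in>multipartitions n. \<forall>\<mu>\<in>multipartitions n. \<nu> \<noteq> \<mu> \<longrightarrow>
           \<not> isomorphic_left_modules (hecke_algebra q v n)
               (V_module q v n \<nu>) (V_module q v n \<mu>)))"
proof -
  interpret G: admissible "generic_q :: 'm generic_field" generic_v n
    by (rule admissible_generic[OF assms])
  have C: "admissible q v n" if "admissible_parameters q v n" for q and v :: "'m \<Rightarrow> complex"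
    using admissible_complex[OF assms that] .
  show ?thesis
    using G.irreducible_V G.not_isomorphic_V admissible.irreducible_V[OF C]
      admissible.not_isomorphic_V[OF C]
    by blast
qed

end
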